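(* Let $f:\mathbb{R}^n\to\mathbb{R}$ be a continuously differentiable function having an isolated minimum at the origin $0$, with $f(0)=0$. Assume that $f$ is proper, that $df(x)\neq 0$ at every point $x$ of the fiber $f^{-1}(t)$ for all $t>0$, and that, for some $\epsilon>0$, the hypersurface $f^{-1}(t)$ is connected for all $t\in(0,\epsilon)$. Then for every $t\in(0,\epsilon)$ the function $V$ is differentiable at $t$ and there exists $\xi\in f^{-1}(t)$ such that $$V'(t)=\frac{A(t)}{\|\nabla f(\xi)\|}.$$
   Context: $V(t)$ denotes the $n$-dimensional Lebesgue measure of the sublevel set $E_t=\{x\in\mathbb{R}^n: f(x)\le t\}$, and $A(t)$ denotes the $(n-1)$-dimensional measure (Euclidean surface area) of the level set $f^{-1}(t)=\{x\in\mathbb{R}^n: f(x)=t\}$. "Proper" means that the preimage under $f$ of every compact set is compact. "Isolated minimum at $0$" means a strict local minimum: $f(x)>f(0)$ for all $x\ne 0$ in some neighborhood of $0$. $\|\cdot\|$ is the Euclidean norm. *)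

theory Defs
  imports "HOL-Analysis.Analysis"
begin

text \<open>
  The \<open>d\<close>-dimensional Hausdorff (outer) measure.  The factor \<open>unit_ball_vol d / 2 ^ d\<close> is the
  normalisation for which it agrees with Lebesgue measure in dimension \<open>d\<close>, so that on
  \<open>d\<close>-dimensional \<open>C\<^sup>1\<close> submanifolds it is the Euclidean surface area.  Covering sets are required
  to be bounded because \<open>diameter\<close> is only meaningful then; empty covering sets are given weight
  \<open>0\<close> separately because \<open>0 ^ 0 = 1\<close>, so that the case \<open>d = 0\<close> is counting measure.
\<close>

definition hausdorff_weight :: "nat \<Rightarrow> 'a::metric_space set \<Rightarrow> ennreal" where
  "hausdorff_weight d C =
     (if C = {} then 0 else ennreal (unit_ball_vol (real d) * (diameter C / 2) ^ d))"

definition hausdorff_content :: "nat \<Rightarrow> real \<Rightarrow> 'a::metric_space set \<Rightarrow> ennreal" where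
  "hausdorff_content d \<delta> A =
     (INF C \<in> {C :: nat \<Rightarrow> 'a set. A \<subseteq> (\<Union>i. C i) \<and> (\<forall>i. bounded (C i) \<and> diameter (C i) \<le> \<delta>)}.
        \<Sum>i. hausdorff_weight d (C i))"

definition hausdorff_measure :: "nat \<Rightarrow> 'a::metric_space set \<Rightarrow> ennreal" where
  "hausdorff_measure d A = (SUP \<delta> \<in> {0<..}. hausdorff_content d \<delta> A)"

definition sublevel_volume :: "(real ^ 'n \<Rightarrow> real) \<Rightarrow> real \<Rightarrow> real" where
  "sublevel_volume f t = measure lebesgue {x. f x \<le> t}"

definition level_area :: "(real ^ 'n \<Rightarrow> real) \<Rightarrow> real \<Rightarrow> real" where
  "level_area f t = enn2real (hausdorff_measure (CARD('n) - 1) {x. f x = t})"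

definition gradient :: "('a::real_inner \<Rightarrow> real) \<Rightarrow> 'a \<Rightarrow> 'a" where
  "gradient f x = (THE D. GDERIV f x :> D)"

end

theory Submission
  imports Defs
begin

text \<open>
  Fix a regular value \<open>t\<close>. Near a point \<open>p\<close> of the compact fibre, \<open>f\<close> is linear up to a relative
  error \<open>\<eta>\<close>, so a small set \<open>C\<close> around \<open>p\<close> meets the slab \<open>a < f \<le> b\<close> in volume at most
  \<open>(b - a) / norm (gradient f p)\<close> times the Hausdorff weight of \<open>C\<close>, up to \<open>1 - \<eta>\<close> (Fubini along
  the gradient and the isodiametric inequality for the shadow of \<open>C\<close>), while small balls attain this
  value up to a factor tending to \<open>1\<close>. Any cover of the fibre by small sets therefore bounds the
  volume of thin slabs from above, and a Vitali family of disjoint balls bounds it from below; the two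
  bounds agree in the limit. This gives differentiability of the volume and shows that the area lies
  between \<open>V'(t)\<close> times the minimum and \<open>V'(t)\<close> times the maximum of the gradient norm on the fibre. Connectedness
  of the fibre yields \<open>\<xi>\<close>.
\<close>

subsection \<open>The isodiametric inequality\<close>

text \<open>The fibre is never parametrized: neither the implicit function theorem nor the coarea
  formula enters. Hausdorff measure admits covers by arbitrary bounded sets, weighted by diameter
  alone, so bounding slab volumes by such covers needs the sharp volume bound for a shadow of given
  diameter; a cruder constant would lose a dimensional factor in the lower bound for the area. The
  opposite bound needs sets that attain equality, that is balls, and a Vitali family is disjoint and
  misses only a part of small weight. The number \<open>V'(t)\<close> is the integral of the
  reciprocal gradient norm over the fibre, but it is visible only through finite sums over balls,
  and the existence of the derivative has to come out of these sums. A separate obstacle is global.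
  Properness controls preimages of compact sets only, so sublevel sets could be unbounded if
  \<open>f\<close> tended to minus infinity. This is excluded because it would create a critical
  point with positive value; the argument uses that the complement of a ball is connected, hence
  dimension at least two, which in turn follows from the connected fibres.\<close>

text \<open>The bound \<open>R\<close> controls both \<open>Sup X - Inf Y\<close> and
  \<open>Sup Y - Inf X\<close>, and these two numbers add up to the lengths of the hulls of
  \<open>X\<close> and \<open>Y\<close>. With two slices of one set this keeps the diameter under
  symmetrization; with \<open>X = Y\<close> it bounds the length of a single slice.\<close>

lemma emeasure_add_le_of_dist_le:
  fixes X Y :: "real set"
  assumes "X \<in> sets borel" "Y \<in> sets borel" "X \<noteq> {}" "Y \<noteq> {}"
    and d: "\<And>s u. s \<in> X \<Longrightarrow> u \<in> Y \<Longrightarrow> \<bar>s - u\<bar> \<le> R"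
  shows "emeasure lborel X + emeasure lborel Y \<le> ennreal (2 * R)"
proof -
  obtain s0 u0 where s0: "s0 \<in> X" and u0: "u0 \<in> Y" using assms by auto
  have bX: "bdd_above X" "bdd_below X"
    using d[OF _ u0] by (auto intro!: bdd_aboveI[of _ "u0 + R"] bdd_belowI[of _ "u0 - R"] simp: abs_le_iff)
      (smt (verit))+
  have bY: "bdd_above Y" "bdd_below Y"
    using d[OF s0] by (auto intro!: bdd_aboveI[of _ "s0 + R"] bdd_belowI[of _ "s0 - R"] simp: abs_le_iff)
      (smt (verit))+
  have 1: "Sup X \<le> Inf Y + R"
  proof (rule cSup_least[OF assms(3)])
    fix x assume x: "x \<in> X"
    have "x - R \<le> Inf Y" by (rule cInf_greatest[OF assms(4)]) (use d[OF x] in \<open>force simp: abs_le_iff\<close>)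
    then show "x \<le> Inf Y + R" by simp
  qed
  have 2: "Sup Y \<le> Inf X + R"
  proof (rule cSup_least[OF assms(4)])
    fix x assume x: "x \<in> Y"
    have "x - R \<le> Inf X" by (rule cInf_greatest[OF assms(3)]) (use d[OF _ x] in \<open>force simp: abs_le_iff\<close>)
    then show "x \<le> Inf X + R" by simp
  qed
  have ne: "Inf X \<le> Sup X" "Inf Y \<le> Sup Y"
    using cInf_le_cSup assms bX bY by auto
  have "emeasure lborel X \<le> emeasure lborel {Inf X..Sup X}"
    by (intro emeasure_mono) (auto intro: cInf_lower[OF _ bX(2)] cSup_upper[OF _ bX(1)])
  moreover have "emeasure lborel Y \<le> emeasure lborel {Inf Y..Sup Y}"
    by (intro emeasure_mono) (auto intro: cInf_lower[OF _ bY(2)] cSup_upper[OF _ bY(1)])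
  ultimately have "emeasure lborel X + emeasure lborel Y \<le> ennreal (Sup X - Inf X) + ennreal (Sup Y - Inf Y)"
    using ne by (intro add_mono) auto
  also have "\<dots> = ennreal ((Sup X - Inf X) + (Sup Y - Inf Y))"
    using ne by (subst ennreal_plus) auto
  also have "\<dots> \<le> ennreal (2 * R)"
    using 1 2 by (intro ennreal_leI) simp
  finally show ?thesis .
qed

text \<open>The length is an extended real, so infinite slices need no separate treatment in the
  symmetrized set, and \<open>c = 0\<close> gives the empty interval.\<close>

lemma emeasure_lborel_centred_interval:
  "emeasure lborel {s::real. ennreal (2 * \<bar>s\<bar>) < c} = c"
proof (cases c)
  case (real r)
  have "{s::real. ennreal (2 * \<bar>s\<bar>) < c} = {- (r/2) <..< r/2}"
    using real by (auto simp: ennreal_less_iff abs_less_iff)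
  then show ?thesis using real by simp
next
  case top
  then show ?thesis by simp
qed

lemma borel_measurable_slice:
  fixes M :: "('i \<Rightarrow> real) set"
  assumes "i \<notin> I" "M \<in> sets (Pi\<^sub>M (insert i I) (\<lambda>_. lborel))"
  shows "(\<lambda>x. \<integral>\<^sup>+s. indicator M (x(i := s)) \<partial>lborel) \<in> borel_measurable (Pi\<^sub>M I (\<lambda>_. lborel :: real measure))"
proof -
  have [measurable]: "M \<in> sets (Pi\<^sub>M (insert i I) (\<lambda>_. lborel))" by fact
  show ?thesis by measurable
qed

lemma slice_in_sets:
  fixes M :: "('i \<Rightarrow> real) set"
  assumes "M \<in> sets (Pi\<^sub>M (insert i I) (\<lambda>_. lborel))" "x \<in> space (Pi\<^sub>M I (\<lambda>_. lborel :: real measure))"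
  shows "{s. x(i := s) \<in> M} \<in> sets borel"
proof -
  have [measurable]: "M \<in> sets (Pi\<^sub>M (insert i I) (\<lambda>_. lborel))" by fact
  have [simp]: "x(i := s) \<in> space (Pi\<^sub>M (insert i I) (\<lambda>_. lborel))" for s
    using assms(2) by (auto simp: space_PiM PiE_def extensional_def)
  have "(\<lambda>s. x(i := s)) \<in> borel \<rightarrow>\<^sub>M Pi\<^sub>M (insert i I) (\<lambda>_. lborel)"
    using measurable_add_dim[of i I "\<lambda>_. lborel :: real measure"] assms(2)
    by (auto dest!: measurable_Pair2[of _ _ _ _ x])
  then have "(\<lambda>s. x(i := s)) -` M \<inter> space borel \<in> sets borel"
    using assms(1) by (rule measurable_sets)
  then show ?thesis by (simp add: vimage_def)
qed

lemma slice_nn_integral: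
  fixes M :: "('i \<Rightarrow> real) set"
  assumes "M \<in> sets (Pi\<^sub>M (insert i I) (\<lambda>_. lborel))" "x \<in> space (Pi\<^sub>M I (\<lambda>_. lborel :: real measure))"
  shows "(\<integral>\<^sup>+s. indicator M (x(i := s)) \<partial>lborel) = emeasure lborel {s. x(i := s) \<in> M}"
proof -
  have "(\<integral>\<^sup>+s. indicator M (x(i := s)) \<partial>lborel) = (\<integral>\<^sup>+s. indicator {s. x(i := s) \<in> M} s \<partial>lborel)"
    by (simp add: indicator_def)
  then show ?thesis using slice_in_sets[OF assms] by simp
qed

lemma emeasure_PiM_insert_slice:
  fixes M :: "('i \<Rightarrow> real) set"
  assumes "finite I" "i \<notin> I" "M \<in> sets (Pi\<^sub>M (insert i I) (\<lambda>_. lborel))"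
  shows "emeasure (Pi\<^sub>M (insert i I) (\<lambda>_. lborel)) M =
    (\<integral>\<^sup>+x. emeasure lborel {s. x(i := s) \<in> M} \<partial>Pi\<^sub>M I (\<lambda>_. lborel :: real measure))"
proof -
  interpret product_sigma_finite "\<lambda>_::'i. lborel :: real measure" by standard
  have "emeasure (Pi\<^sub>M (insert i I) (\<lambda>_. lborel)) M = (\<integral>\<^sup>+x. indicator M x \<partial>Pi\<^sub>M (insert i I) (\<lambda>_. lborel))"
    using assms by simp
  also have "\<dots> = (\<integral>\<^sup>+x. (\<integral>\<^sup>+s. indicator M (x(i := s)) \<partial>lborel) \<partial>Pi\<^sub>M I (\<lambda>_. lborel))"
    using assms by (intro product_nn_integral_insert) auto
  finally show ?thesis using assms by (simp add: slice_nn_integral cong: nn_integral_cong)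
qed

text \<open>Replacing slices by \<^emph>\<open>open\<close> centred intervals makes the slices over null slices empty, so every
  point of the symmetrized set comes with points of the original set on the same line.\<close>
lemma steiner_symmetrization:
  fixes M :: "('i \<Rightarrow> real) set"
  assumes I: "finite I" "i \<notin> I"
    and M: "M \<in> sets (Pi\<^sub>M (insert i I) (\<lambda>_. lborel))"
    and diam: "\<And>x y. x \<in> M \<Longrightarrow> y \<in> M \<Longrightarrow> (\<Sum>j\<in>insert i I. (x j - y j)\<^sup>2) \<le> E"
  obtains N where "N \<in> sets (Pi\<^sub>M (insert i I) (\<lambda>_. lborel))"
    "emeasure (Pi\<^sub>M (insert i I) (\<lambda>_. lborel)) N = emeasure (Pi\<^sub>M (insert i I) (\<lambda>_. lborel)) M"
    "\<And>x y. x \<in> N \<Longrightarrow> y \<in> N \<Longrightarrow> (\<Sum>j\<in>insert i I. (x j - y j)\<^sup>2) \<le> E"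
    "\<And>x. x \<in> N \<Longrightarrow> x(i := - x i) \<in> N"
    "\<And>j x. j \<in> I \<Longrightarrow> (\<And>x. x \<in> M \<Longrightarrow> x(j := - x j) \<in> M) \<Longrightarrow> x \<in> N \<Longrightarrow> x(j := - x j) \<in> N"
proof -
  let ?P = "\<lambda>I. Pi\<^sub>M I (\<lambda>_::'i. lborel :: real measure)"
  define l where "l x = (\<integral>\<^sup>+s. indicator M (x(i := s)) \<partial>lborel)" for x
  have [measurable]: "l \<in> borel_measurable (?P I)"
    unfolding l_def[abs_def] using I M by (intro borel_measurable_slice)
  have l_upd: "l (y(i := s)) = l y" for y s
    unfolding l_def by simp
  have l_restrict: "l (restrict y I) = l y" if "y \<in> space (?P (insert i I))" for y
  proof -
    have "(restrict y I)(i := s) = y(i := s)" for s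
      using that by (auto simp: space_PiM PiE_def extensional_def restrict_def)
    then show ?thesis unfolding l_def by simp
  qed
  have l_eq: "l y = emeasure lborel {s. y(i := s) \<in> M}" "{s. y(i := s) \<in> M} \<in> sets borel"
    if "y \<in> space (?P (insert i I))" for y
  proof -
    have r: "restrict y I \<in> space (?P I)"
      using that by (auto simp: space_PiM)
    have e: "(restrict y I)(i := s) = y(i := s)" for s
      using that by (auto simp: space_PiM PiE_def extensional_def restrict_def)
    show "l y = emeasure lborel {s. y(i := s) \<in> M}" "{s. y(i := s) \<in> M} \<in> sets borel"
      using slice_nn_integral[OF M r] slice_in_sets[OF M r] e by (auto simp: l_def)
  qed
  \<comment> \<open>\<open>l\<close> is known to be measurable on the product over \<open>I\<close>
    only, so the definition goes through \<open>restrict y I\<close>; \<open>Neq\<close> removes the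
    restriction again.\<close>
  define N where "N = {y \<in> space (?P (insert i I)). ennreal (2 * \<bar>y i\<bar>) < l (restrict y I)}"
  have Nm: "N \<in> sets (?P (insert i I))"
    unfolding N_def by measurable
  have Neq: "y \<in> N \<longleftrightarrow> y \<in> space (?P (insert i I)) \<and> ennreal (2 * \<bar>y i\<bar>) < l y" for y
    by (auto simp: N_def l_restrict)
  show ?thesis
  proof (rule that[of N])
    show "N \<in> sets (?P (insert i I))" by (fact Nm)
    have "emeasure lborel {s. x(i := s) \<in> N} = emeasure lborel {s. x(i := s) \<in> M}"
      if x: "x \<in> space (?P I)" for x
    proof -
      have [simp]: "x(i := s) \<in> space (?P (insert i I))" for s
        using x by (auto simp: space_PiM PiE_def extensional_def)
      have "{s. x(i := s) \<in> N} = {s. ennreal (2 * \<bar>s\<bar>) < l x}"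
        by (auto simp: Neq l_upd)
      then have "emeasure lborel {s. x(i := s) \<in> N} = l x"
        by (simp add: emeasure_lborel_centred_interval)
      then show ?thesis using slice_nn_integral[OF M x] by (simp add: l_def)
    qed
    then show "emeasure (?P (insert i I)) N = emeasure (?P (insert i I)) M"
      using I M Nm by (simp add: emeasure_PiM_insert_slice cong: nn_integral_cong)
    show "x(i := - x i) \<in> N" if "x \<in> N" for x
      using that by (auto simp: Neq l_upd space_PiM PiE_def extensional_def)
    \<comment> \<open>Reflecting in a coordinate other than \<open>i\<close> carries a slice of
      \<open>M\<close> to a slice consisting of the same numbers \<open>s\<close>, so the lengths
      agree. Hence later symmetrizations do not destroy the earlier ones.\<close>
    show "x(j := - x j) \<in> N" if j: "j \<in> I" and sym: "\<And>x. x \<in> M \<Longrightarrow> x(j := - x j) \<in> M" and x: "x \<in> N" for j x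
    proof -
      have ji: "j \<noteq> i" using I j by auto
      have "(x(j := - x j, i := s) \<in> M) = (x(i := s) \<in> M)" for s
      proof -
        have "x(i := s, j := x j) = x(i := s)" using ji by auto
        then show ?thesis
          using sym[of "x(i := s)"] sym[of "x(j := - x j, i := s)"] ji by (auto simp: fun_upd_twist)
      qed
      then have "l (x(j := - x j)) = l x" unfolding l_def by (simp add: indicator_def)
      then show ?thesis using x j ji by (auto simp: Neq space_PiM PiE_def extensional_def)
    qed
    fix x y assume xy: "x \<in> N" "y \<in> N"
    then have xs: "x \<in> space (?P (insert i I))" "y \<in> space (?P (insert i I))" 
      and lx: "ennreal (2 * \<bar>x i\<bar>) < l x" and ly: "ennreal (2 * \<bar>y i\<bar>) < l y" by (auto simp: Neq)
    let ?X = "{s. x(i := s) \<in> M}" and ?Y = "{s. y(i := s) \<in> M}"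
    \<comment> \<open>\<open>c\<close> is the squared distance of the two lines. Symmetrization
      moves points along these lines only, so \<open>E - c\<close> is what remains for coordinate
      \<open>i\<close>.\<close>
    define c where "c = (\<Sum>j\<in>I. (x j - y j)\<^sup>2)"
    have d: "(s - u)\<^sup>2 + c \<le> E" if "s \<in> ?X" "u \<in> ?Y" for s u
    proof -
      have "(\<Sum>j\<in>I. ((x(i := s)) j - (y(i := u)) j)\<^sup>2) = c"
        unfolding c_def using I by (intro sum.cong) auto
      then show ?thesis using diam[of "x(i := s)" "y(i := u)"] that I by simp
    qed
    have "l x \<noteq> 0" "l y \<noteq> 0" using lx ly by auto
    then have ne: "?X \<noteq> {}" "?Y \<noteq> {}"
      using l_eq[OF xs(1)] l_eq[OF xs(2)] emeasure_empty by metis+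
    then have E: "0 \<le> E - c" using d zero_le_power2 by (smt (verit) Collect_empty_eq mem_Collect_eq)
    have "emeasure lborel ?X + emeasure lborel ?Y \<le> ennreal (2 * sqrt (E - c))"
    proof (rule emeasure_add_le_of_dist_le)
      fix s u assume "s \<in> ?X" "u \<in> ?Y"
      then show "\<bar>s - u\<bar> \<le> sqrt (E - c)"
        using d[of s u] by (intro real_le_rsqrt) auto
    qed (use ne l_eq xs in auto)
    \<comment> \<open>Centred intervals are the best position: points of two of them differ by at
      most half the sum of the lengths.\<close>
    moreover have "ennreal (2 * \<bar>x i\<bar>) + ennreal (2 * \<bar>y i\<bar>) \<le> l x + l y"
      using lx ly by (intro add_mono) auto
    ultimately have "ennreal (2 * \<bar>x i\<bar> + 2 * \<bar>y i\<bar>) \<le> ennreal (2 * sqrt (E - c))"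
      using l_eq[OF xs(1)] l_eq[OF xs(2)] by (subst ennreal_plus) auto
    then have "2 * \<bar>x i\<bar> + 2 * \<bar>y i\<bar> \<le> 2 * sqrt (E - c)"
      using E by (subst (asm) ennreal_le_iff) auto
    then have "\<bar>x i - y i\<bar> \<le> sqrt (E - c)" by linarith
    then have "(x i - y i)\<^sup>2 \<le> E - c"
      using E by (metis abs_ge_zero power2_abs power_mono real_sqrt_pow2)
    then show "(\<Sum>j\<in>insert i I. (x j - y j)\<^sup>2) \<le> E"
      using I by (simp add: c_def)
  qed
qed

text \<open>Induction on \<open>B\<close>, the coordinates already treated; the last property in
  \<open>steiner_symmetrization\<close> carries the earlier reflections along. The result need not
  be a ball, but its reflections are enough below.\<close>

lemma iterated_steiner_symmetrization:
  fixes M :: "('i \<Rightarrow> real) set"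
  assumes A: "finite A" and B: "B \<subseteq> A"
    and M: "M \<in> sets (Pi\<^sub>M A (\<lambda>_. lborel))"
    and diam: "\<And>x y. x \<in> M \<Longrightarrow> y \<in> M \<Longrightarrow> (\<Sum>j\<in>A. (x j - y j)\<^sup>2) \<le> E"
  shows "\<exists>N \<in> sets (Pi\<^sub>M A (\<lambda>_. lborel)).
    emeasure (Pi\<^sub>M A (\<lambda>_. lborel)) N = emeasure (Pi\<^sub>M A (\<lambda>_. lborel)) M \<and>
    (\<forall>x\<in>N. \<forall>y\<in>N. (\<Sum>j\<in>A. (x j - y j)\<^sup>2) \<le> E) \<and> (\<forall>j\<in>B. \<forall>x\<in>N. x(j := - x j) \<in> N)"
  using finite_subset[OF B A] B
proof (induction B rule: finite_induct)
  case empty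
  then show ?case using M diam by blast
next
  case (insert i B)
  then obtain N where N: "N \<in> sets (Pi\<^sub>M A (\<lambda>_. lborel))"
    "emeasure (Pi\<^sub>M A (\<lambda>_. lborel)) N = emeasure (Pi\<^sub>M A (\<lambda>_. lborel)) M"
    "\<forall>x\<in>N. \<forall>y\<in>N. (\<Sum>j\<in>A. (x j - y j)\<^sup>2) \<le> E" "\<forall>j\<in>B. \<forall>x\<in>N. x(j := - x j) \<in> N"
    by blast
  have eq: "insert i (A - {i}) = A" using insert by auto
  have fin: "finite (A - {i})" "i \<notin> A - {i}" using A by auto
  obtain N' where N': "N' \<in> sets (Pi\<^sub>M A (\<lambda>_. lborel))"
    "emeasure (Pi\<^sub>M A (\<lambda>_. lborel)) N' = emeasure (Pi\<^sub>M A (\<lambda>_. lborel)) N"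
    "\<And>x y. x \<in> N' \<Longrightarrow> y \<in> N' \<Longrightarrow> (\<Sum>j\<in>A. (x j - y j)\<^sup>2) \<le> E"
    "\<And>x. x \<in> N' \<Longrightarrow> x(i := - x i) \<in> N'"
    "\<And>j x. j \<in> A - {i} \<Longrightarrow> (\<And>x. x \<in> N \<Longrightarrow> x(j := - x j) \<in> N) \<Longrightarrow> x \<in> N' \<Longrightarrow> x(j := - x j) \<in> N'"
    by (rule steiner_symmetrization[OF fin, unfolded eq, of N E]) (use N in auto)
  show ?case
  proof (intro bexI[of _ N'] conjI ballI)
    fix j x assume j: "j \<in> insert i B" and x: "x \<in> N'"
    show "x(j := - x j) \<in> N'"
    proof (cases "j = i")
      case False
      then have "j \<in> B" "j \<in> A - {i}" using j insert.prems by auto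
      then show ?thesis using N'(5)[of j x] N(4) x by blast
    qed (use N'(4) x in auto)
  qed (use N N' in auto)
qed

text \<open>A set of diameter \<open>D\<close> need not lie in a ball of radius
  \<open>D / 2\<close>, as an equilateral triangle shows. After symmetrization in all coordinates it
  does: with \<open>x\<close> it contains the opposite point, at distance twice the norm of
  \<open>x\<close>.\<close>

theorem isodiametric_inequality:
  fixes M :: "('i \<Rightarrow> real) set"
  assumes A: "finite A" and M: "M \<in> sets (Pi\<^sub>M A (\<lambda>_. lborel))" and D: "D \<ge> 0"
    and diam: "\<And>x y. x \<in> M \<Longrightarrow> y \<in> M \<Longrightarrow> (\<Sum>j\<in>A. (x j - y j)\<^sup>2) \<le> D\<^sup>2"
  shows "emeasure (Pi\<^sub>M A (\<lambda>_. lborel)) M \<le> ennreal (unit_ball_vol (real (card A)) * (D / 2) ^ card A)"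
proof -
  let ?P = "Pi\<^sub>M A (\<lambda>_::'i. lborel :: real measure)"
  obtain N where N: "N \<in> sets ?P" "emeasure ?P N = emeasure ?P M"
    "\<And>x y. x \<in> N \<Longrightarrow> y \<in> N \<Longrightarrow> (\<Sum>j\<in>A. (x j - y j)\<^sup>2) \<le> D\<^sup>2" 
    "\<And>j x. j \<in> A \<Longrightarrow> x \<in> N \<Longrightarrow> x(j := - x j) \<in> N"
    using iterated_steiner_symmetrization[OF A order_refl M diam] by blast
  have sym: "(\<lambda>j. if j \<in> B then - x j else x j) \<in> N" if "x \<in> N" "B \<subseteq> A" for x B
    using finite_subset[OF that(2) A] that(2)
  proof (induction B rule: finite_induct)
    case (insert i B)
    have "(\<lambda>j. if j \<in> insert i B then - x j else x j) =
      (\<lambda>j. if j \<in> B then - x j else x j)(i := - (\<lambda>j. if j \<in> B then - x j else x j) i)"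
      using insert.hyps by auto
    then show ?case using N(4)[of i "\<lambda>j. if j \<in> B then - x j else x j"] insert by auto
  qed (use that in simp)
  have norm: "sqrt (\<Sum>j\<in>A. (x j)\<^sup>2) \<le> D / 2" if x: "x \<in> N" for x
  proof -
    have "(\<Sum>j\<in>A. (x j - (if j \<in> A then - x j else x j))\<^sup>2) = (\<Sum>j\<in>A. 4 * (x j)\<^sup>2)"
      by (intro sum.cong) (auto simp: power2_eq_square)
    then have "4 * (\<Sum>j\<in>A. (x j)\<^sup>2) \<le> D\<^sup>2"
      using N(3)[OF x sym[OF x order_refl]] by (simp add: sum_distrib_left)
    then show ?thesis
      using D by (intro real_le_lsqrt) (auto simp: power_divide intro: sum_nonneg)
  qed
  \<comment> \<open>\<open>emeasure_cball_aux\<close> asks for a positive radius, so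
    \<open>D = 0\<close> is reached by letting \<open>r\<close> decrease to \<open>0\<close>; for
    empty \<open>A\<close> the limit correctly involves \<open>0 ^ 0 = 1\<close>.\<close>
  have bd: "emeasure ?P N \<le> ennreal (unit_ball_vol (real (card A)) * r ^ card A)" if r: "r > 0" "r \<ge> D / 2" for r
  proof -
    have "N \<subseteq> {f. sqrt (\<Sum>i\<in>A. (f i)\<^sup>2) \<le> r} \<inter> space ?P"
      using norm r sets.sets_into_space[OF N(1)] by force
    then have "emeasure ?P N \<le> emeasure ?P ({f. sqrt (\<Sum>i\<in>A. (f i)\<^sup>2) \<le> r} \<inter> space ?P)"
      by (intro emeasure_mono) auto
    then show ?thesis using emeasure_cball_aux[OF A r(1)] by simp
  qed
  show ?thesis
  proof (cases "D = 0")
    case False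
    then show ?thesis using bd[of "D/2"] D N by simp
  next
    case True
    have "((\<lambda>r. ennreal (unit_ball_vol (real (card A)) * r ^ card A)) \<longlongrightarrow> ennreal (unit_ball_vol (real (card A)) * 0 ^ card A)) (at_right 0)"
      by (intro tendsto_intros tendsto_ennrealI)
    moreover have "\<forall>\<^sub>F r in at_right 0. emeasure ?P N \<le> ennreal (unit_ball_vol (real (card A)) * r ^ card A)"
      using bd True by (auto simp: eventually_at_right_less intro!: eventually_mono[OF eventually_at_right_less])
    ultimately have "emeasure ?P N \<le> ennreal (unit_ball_vol (real (card A)) * 0 ^ card A)"
      by (intro tendsto_le[OF _ _ tendsto_const]) auto
    then show ?thesis using True N by simp
  qed
qed

subsection \<open>Rotation invariance of Lebesgue measure\<close>

text \<open>Uniqueness of Haar measure by Fubini: integrate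
  \<open>indicator A x * indicator B (y + x)\<close> over both measures. The inner integral over
  \<open>y\<close> gives the left side. Shifting \<open>x\<close> by \<open>y\<close> under \<nu>
  first, and then integrating over \<open>y\<close>, gives the right side, where
  \<open>x - y\<close> produces the reflected set.\<close>

lemma lborel_translation_invariant_unique:
  fixes \<nu> :: "'a::euclidean_space measure"
  assumes sets: "sets \<nu> = sets borel" and fin: "sigma_finite_measure \<nu>"
    and trans: "\<And>c. distr \<nu> borel ((+) c) = \<nu>"
    and A: "A \<in> sets borel" and B: "B \<in> sets borel"
  shows "emeasure \<nu> A * emeasure lborel B = emeasure \<nu> B * emeasure lborel (uminus ` A)"
proof -
  note [measurable_cong] = sets
  note [measurable] = A B
  have sp: "space \<nu> = UNIV" using sets_eq_imp_space_eq[OF sets] by simp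
  interpret n: sigma_finite_measure \<nu> by fact
  interpret pair_sigma_finite \<nu> lborel ..
  have mA: "uminus ` A \<in> sets borel"
  proof -
    have "uminus ` A = uminus -` A \<inter> space borel" by force
    then show ?thesis
      using measurable_sets[of "uminus :: 'a \<Rightarrow> 'a" borel borel A] A by (simp del: space_borel)
  qed
  note [measurable] = mA
  have uminus_image: "z \<in> uminus ` A \<longleftrightarrow> - z \<in> A" for z
    by force
  have tl: "(\<integral>\<^sup>+y. h (y + c) \<partial>lborel) = (\<integral>\<^sup>+y. h y \<partial>lborel)" if [measurable]: "h \<in> borel_measurable borel" for h :: "'a \<Rightarrow> ennreal" and c
    by (subst (2) lborel_distr_plus[of c, symmetric]) (simp add: nn_integral_distr add.commute)
  have tn: "(\<integral>\<^sup>+y. h (y + c) \<partial>\<nu>) = (\<integral>\<^sup>+y. h y \<partial>\<nu>)" if [measurable]: "h \<in> borel_measurable borel" for h :: "'a \<Rightarrow> ennreal" and c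
    by (subst (2) trans[of c, symmetric]) (simp add: nn_integral_distr add.commute)
  have "emeasure \<nu> A * emeasure lborel B = (\<integral>\<^sup>+x. indicator A x * emeasure lborel B \<partial>\<nu>)"
    by (simp add: nn_integral_multc sets)
  also have "\<dots> = (\<integral>\<^sup>+x. (\<integral>\<^sup>+y. indicator A x * indicator B (y + x) \<partial>lborel) \<partial>\<nu>)"
    by (subst nn_integral_cmult) (simp_all add: tl[of "indicator B"])
  also have "\<dots> = (\<integral>\<^sup>+y. (\<integral>\<^sup>+x. indicator A x * indicator B (y + x) \<partial>\<nu>) \<partial>lborel)"
    by (rule Fubini'[symmetric]) measurable
  also have "\<dots> = (\<integral>\<^sup>+y. (\<integral>\<^sup>+x. indicator A (x - y) * indicator B x \<partial>\<nu>) \<partial>lborel)"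
  proof (rule nn_integral_cong)
    fix y :: 'a
    show "(\<integral>\<^sup>+x. indicator A x * indicator B (y + x) \<partial>\<nu>) = (\<integral>\<^sup>+x. indicator A (x - y) * indicator B x \<partial>\<nu> :: ennreal)"
      using tn[of "\<lambda>x. indicator A (x - y) * indicator B x" y] by (simp add: add.commute)
  qed
  also have "\<dots> = (\<integral>\<^sup>+x. (\<integral>\<^sup>+y. indicator A (x - y) * indicator B x \<partial>lborel) \<partial>\<nu>)"
    by (rule Fubini') measurable
  also have "\<dots> = (\<integral>\<^sup>+x. (\<integral>\<^sup>+y. indicator (uminus ` A) (y - x) * indicator B x \<partial>lborel) \<partial>\<nu>)"
    by (simp add: indicator_def uminus_image)
  also have "\<dots> = (\<integral>\<^sup>+x. emeasure lborel (uminus ` A) * indicator B x \<partial>\<nu>)"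
  proof (intro nn_integral_cong)
    fix x :: 'a
    show "(\<integral>\<^sup>+y. indicator (uminus ` A) (y - x) * indicator B x \<partial>lborel) = emeasure lborel (uminus ` A) * (indicator B x :: ennreal)"
      using tl[of "indicator (uminus ` A)" "- x"] by (subst nn_integral_multc) simp_all
  qed
  also have "\<dots> = emeasure \<nu> B * emeasure lborel (uminus ` A)"
    by (subst nn_integral_cmult) (simp_all add: sets mult.commute)
  finally show ?thesis .
qed

text \<open>The image measure is again translation invariant because \<open>T\<close> is linear and
  onto, hence proportional to Lebesgue measure; the unit ball is its own preimage and fixes the
  factor. This allows slicing along a gradient instead of a coordinate axis.\<close>

lemma lborel_distr_orthogonal:
  fixes T :: "'a::euclidean_space \<Rightarrow> 'a"
  assumes T: "orthogonal_transformation T"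
  shows "distr lborel borel T = lborel"
proof (rule measure_eqI)
  let ?N = "distr lborel borel T :: 'a measure"
  have lin: "linear T" using T by (rule orthogonal_transformation_linear)
  then have [measurable]: "T \<in> borel_measurable borel"
    by (intro borel_measurable_continuous_onI linear_continuous_on linear_conv_bounded_linear[THEN iffD1])
  have norm: "norm (T x) = norm x" for x using T by (simp add: orthogonal_transformation_norm)
  have surj: "surj T" using T by (simp add: orthogonal_transformation_surj)
  have pre: "T -` ball 0 r = ball 0 r" for r by (auto simp: norm)
  have fin: "sigma_finite_measure ?N"
  proof
    show "\<exists>A. countable A \<and> A \<subseteq> sets ?N \<and> \<Union> A = space ?N \<and> (\<forall>a\<in>A. emeasure ?N a \<noteq> \<infinity>)"
    proof (intro exI[of _ "range (\<lambda>n::nat. ball 0 (real n))"] conjI ballI)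
      show "\<Union> (range (\<lambda>n::nat. ball (0::'a) (real n))) = space ?N"
        using reals_Archimedean2 by auto
      fix a assume "a \<in> range (\<lambda>n::nat. ball (0::'a) (real n))"
      then obtain n where a: "a = ball 0 (real n)" by auto
      then show "emeasure ?N a \<noteq> \<infinity>"
        using emeasure_lborel_ball_finite[of "0::'a" "real n"] by (simp add: emeasure_distr pre)
    qed auto
  qed
  have trans: "distr ?N borel ((+) c) = ?N" for c
  proof -
    obtain b where b: "c = T b" using surj by auto
    have "distr ?N borel ((+) c) = distr lborel borel (T \<circ> (+) b)"
      by (subst distr_distr) (auto simp: o_def b linear_add[OF lin])
    also have "\<dots> = distr (distr lborel borel ((+) b)) borel T"
      by (subst distr_distr) (auto simp: o_def)
    finally show ?thesis by (simp add: lborel_distr_plus)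
  qed
  show "sets ?N = sets lborel" by simp
  fix A assume "A \<in> sets ?N"
  then have A: "A \<in> sets borel" by simp
  let ?B = "ball (0::'a) 1"
  have 1: "emeasure ?N A * emeasure lborel ?B = emeasure ?N ?B * emeasure lborel (uminus ` A)"
    by (rule lborel_translation_invariant_unique[OF _ fin trans A]) auto
  \<comment> \<open>The same identity for Lebesgue measure itself eliminates the reflected
    set.\<close>
  have 2: "emeasure lborel A * emeasure lborel ?B = emeasure lborel ?B * emeasure lborel (uminus ` A)"
    by (rule lborel_translation_invariant_unique[OF _ _ lborel_distr_plus A])
      (auto intro: lborel.sigma_finite_measure_axioms)
  have 3: "emeasure ?N ?B = emeasure lborel ?B" by (simp add: emeasure_distr pre)
  have 4: "emeasure lborel ?B \<noteq> 0"
    using emeasure_ball[of 1 "0::'a"] unit_ball_vol_pos[of "real DIM('a)"]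
    by (simp add: less_imp_neq[symmetric] del: unit_ball_vol_pos)
  have 5: "emeasure lborel ?B \<noteq> \<infinity>"
    using emeasure_lborel_ball_finite[of "0::'a" 1] by simp
  from 1 2 3 have "emeasure ?N A * emeasure lborel ?B = emeasure lborel A * emeasure lborel ?B" by simp
  then show "emeasure ?N A = emeasure lborel A"
    using 4 5 by (metis ennreal_mult_right_cong infinity_ennreal_def mult.commute ennreal_mult_cancel_left)
qed

subsection \<open>Volumes of thin and thick sets\<close>

lemma emeasure_lborel_slices:
  fixes k :: "'a::euclidean_space"
  assumes k: "k \<in> Basis" and M: "M \<in> sets borel"
  defines "e \<equiv> \<lambda>x s. (\<Sum>b\<in>Basis - {k}. x b *\<^sub>R b) + s *\<^sub>R k"
  shows "emeasure lborel M =
    (\<integral>\<^sup>+x. emeasure lborel {s. e x s \<in> M} \<partial>Pi\<^sub>M (Basis - {k}) (\<lambda>_. lborel :: real measure))" (is ?A)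
    and "(\<lambda>x. emeasure lborel {s. e x s \<in> M}) \<in> borel_measurable (Pi\<^sub>M (Basis - {k}) (\<lambda>_. lborel))" (is ?B)
    and "x \<in> space (Pi\<^sub>M (Basis - {k}) (\<lambda>_. lborel)) \<Longrightarrow> {s. e x s \<in> M} \<in> sets borel"
proof -
  let ?I = "Basis - {k}" and ?P = "\<lambda>I. Pi\<^sub>M I (\<lambda>_::'a. lborel :: real measure)"
  let ?h = "\<lambda>f. \<Sum>b\<in>Basis. f b *\<^sub>R b :: 'a"
  have ins: "insert k ?I = Basis" using k by auto
  have [measurable]: "M \<in> sets borel" by fact
  have hm: "?h \<in> ?P Basis \<rightarrow>\<^sub>M borel" by measurable
  define N where "N = ?h -` M \<inter> space (?P Basis)"
  have N: "N \<in> sets (?P (insert k ?I))" unfolding N_def ins using hm M by (rule measurable_sets)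
  have sl: "{s. x(k := s) \<in> N} = {s. e x s \<in> M}" if "x \<in> space (?P ?I)" for x
  proof -
    have "?h (x(k := s)) = e x s" for s
      unfolding e_def using k
      by (subst sum.remove[OF finite_Basis k]) (auto simp: add.commute intro!: arg_cong2[of _ _ _ _ "(+)"] sum.cong)
    moreover have "x(k := s) \<in> space (?P Basis)" for s
      using that k by (auto simp: space_PiM PiE_def extensional_def)
    ultimately show ?thesis by (auto simp: N_def)
  qed
  have "emeasure lborel M = emeasure (?P (insert k ?I)) N"
    unfolding N_def ins by (subst lborel_eq, subst emeasure_distr) (use hm in auto)
  also have "\<dots> = (\<integral>\<^sup>+x. emeasure lborel {s. x(k := s) \<in> N} \<partial>?P ?I)"
    using N by (intro emeasure_PiM_insert_slice) auto
  finally show ?A using sl by (simp cong: nn_integral_cong)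
  have "(\<lambda>x. \<integral>\<^sup>+s. indicator N (x(k := s)) \<partial>lborel) \<in> borel_measurable (?P ?I)"
    using N by (intro borel_measurable_slice) auto
  then show ?B using sl slice_nn_integral[OF N] by (simp cong: measurable_cong)
  show "{s. e x s \<in> M} \<in> sets borel" if "x \<in> space (?P ?I)"
    using slice_in_sets[OF N that] sl[OF that] by simp
qed

lemma norm_slice_embedding:
  fixes k :: "'a::euclidean_space"
  assumes k: "k \<in> Basis"
  shows "(norm ((\<Sum>b\<in>Basis - {k}. x b *\<^sub>R b) + s *\<^sub>R k))\<^sup>2 = (\<Sum>b\<in>Basis - {k}. (x b)\<^sup>2) + s\<^sup>2"
proof -
  have "(\<Sum>b\<in>Basis - {k}. x b *\<^sub>R b) + s *\<^sub>R k = (\<Sum>b\<in>Basis. (x(k := s)) b *\<^sub>R b)"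
    by (subst sum.remove[OF finite_Basis k]) (auto simp: add.commute intro!: arg_cong2[of _ _ _ _ "(+)"] sum.cong)
  also have "(norm \<dots>)\<^sup>2 = (\<Sum>b\<in>Basis. ((x(k := s)) b)\<^sup>2)"
    unfolding power2_norm_eq_inner by (subst euclidean_inner) (simp add: power2_eq_square inner_sum_left_Basis cong: sum.cong)
  also have "\<dots> = (\<Sum>b\<in>Basis - {k}. (x b)\<^sup>2) + s\<^sup>2"
    by (subst sum.remove[OF finite_Basis k]) (auto simp: add.commute intro!: sum.cong)
  finally show ?thesis .
qed

text \<open>Fubini along \<open>k\<close>: every slice has length at most \<open>L\<close>, and the
  shadow of \<open>M\<close> orthogonal to \<open>k\<close> has diameter at most \<open>D\<close>,
  so the isodiametric inequality applies to it in one dimension less.\<close>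

lemma emeasure_lborel_le_Basis:
  fixes M :: "'a::euclidean_space set"
  assumes k: "k \<in> Basis" and M: "M \<in> sets borel" and D: "D \<ge> 0" and L: "L \<ge> 0"
    and diam: "\<And>x y. x \<in> M \<Longrightarrow> y \<in> M \<Longrightarrow> dist x y \<le> D"
    and thin: "\<And>x u. x \<in> M \<Longrightarrow> x + u *\<^sub>R k \<in> M \<Longrightarrow> \<bar>u\<bar> \<le> L"
  shows "emeasure lborel M \<le> ennreal (unit_ball_vol (real (DIM('a) - 1)) * (D / 2) ^ (DIM('a) - 1) * L)"
proof -
  let ?I = "Basis - {k}" 
  let ?P = "Pi\<^sub>M ?I (\<lambda>_::'a. lborel :: real measure)"
  define e where "e x s = (\<Sum>b\<in>?I. x b *\<^sub>R b) + s *\<^sub>R k" for x s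
  define l where "l x = emeasure lborel {s. e x s \<in> M}" for x
  note sl = emeasure_lborel_slices[OF k M, folded e_def l_def]
  have [measurable]: "l \<in> borel_measurable ?P" using sl(2) by (simp add: l_def[abs_def])
  have card: "card ?I = DIM('a) - 1" using k by simp
  \<comment> \<open>The projection of a Borel set need not be Borel. The lines met in positive
    length form a measurable set and carry the whole integral.\<close>
  define N where "N = {x \<in> space ?P. l x > 0}"
  have [measurable]: "N \<in> sets ?P" unfolding N_def by measurable
  have lL: "l x \<le> ennreal L * indicator N x" if x: "x \<in> space ?P" for x
  proof (cases "l x = 0")
    case False
    then have ne: "{s. e x s \<in> M} \<noteq> {}" unfolding l_def by (metis emeasure_empty)
    have "l x + l x \<le> ennreal (2 * L)" unfolding l_def
    proof (rule emeasure_add_le_of_dist_le)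
      fix s u assume "s \<in> {s. e x s \<in> M}" "u \<in> {s. e x s \<in> M}"
      then show "\<bar>s - u\<bar> \<le> L" using thin[of "e x u" "s - u"] by (simp add: e_def algebra_simps)
    qed (use ne sl(3)[OF x] in auto)
    then have "l x \<le> ennreal L" using L
      by (cases "l x") (auto simp: top_unique simp flip: ennreal_plus)
    then show ?thesis using False x by (simp add: N_def zero_less_iff_neq_zero)
  qed simp
  have "emeasure lborel M \<le> (\<integral>\<^sup>+x. ennreal L * indicator N x \<partial>?P)"
    unfolding sl(1) by (intro nn_integral_mono lL)
  also have "\<dots> = ennreal L * emeasure ?P N"
    by (rule nn_integral_cmult_indicator) measurable
  also have "\<dots> \<le> ennreal L * ennreal (unit_ball_vol (real (card ?I)) * (D / 2) ^ card ?I)"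
  proof (intro mult_left_mono isodiametric_inequality)
    fix x y assume xy: "x \<in> N" "y \<in> N"
    have "\<exists>s. e z s \<in> M" if "z \<in> N" for z
      using that unfolding N_def l_def by (metis (mono_tags, lifting) Collect_empty_eq emeasure_empty less_irrefl mem_Collect_eq)
    then obtain s u where su: "e x s \<in> M" "e y u \<in> M" using xy by blast
    have "e x s - e y u = (\<Sum>b\<in>?I. (x b - y b) *\<^sub>R b) + (s - u) *\<^sub>R k"
      by (simp add: e_def algebra_simps sum_subtractf)
    then have "(norm (e x s - e y u))\<^sup>2 = (\<Sum>b\<in>?I. (x b - y b)\<^sup>2) + (s - u)\<^sup>2"
      using norm_slice_embedding[OF k, of "\<lambda>b. x b - y b" "s - u"] by simp
    moreover have "(norm (e x s - e y u))\<^sup>2 \<le> D\<^sup>2"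
      using diam[OF su] by (intro power_mono) (auto simp: dist_norm)
    ultimately show "(\<Sum>j\<in>?I. (x j - y j)\<^sup>2) \<le> D\<^sup>2" using zero_le_power2[of "s - u"] by linarith
  qed (use D in auto)
  finally show ?thesis using L D by (simp add: card ennreal_mult'' mult.commute)
qed

text \<open>Only the length of the interval on each line matters. Its position \<alpha> varies with
  the line, following a level set, and no measurable choice of it is required, since the slice
  lengths are measurable anyway.\<close>

lemma emeasure_lborel_ge_Basis:
  fixes M :: "'a::euclidean_space set"
  assumes k: "k \<in> Basis" and M: "M \<in> sets borel" and \<rho>: "\<rho> > 0" and L: "L \<ge> 0"
    and thick: "\<And>v. v \<bullet> k = 0 \<Longrightarrow> norm v \<le> \<rho> \<Longrightarrow> \<exists>\<alpha>. \<forall>s. \<alpha> < s \<and> s \<le> \<alpha> + L \<longrightarrow> v + s *\<^sub>R k \<in> M"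
  shows "ennreal (unit_ball_vol (real (DIM('a) - 1)) * \<rho> ^ (DIM('a) - 1) * L) \<le> emeasure lborel M"
proof -
  let ?I = "Basis - {k}" 
  let ?P = "Pi\<^sub>M ?I (\<lambda>_::'a. lborel :: real measure)"
  define e where "e x s = (\<Sum>b\<in>?I. x b *\<^sub>R b) + s *\<^sub>R k" for x s
  define l where "l x = emeasure lborel {s. e x s \<in> M}" for x
  note sl = emeasure_lborel_slices[OF k M, folded e_def l_def]
  have card: "card ?I = DIM('a) - 1" using k by simp
  define B where "B = {x. sqrt (\<Sum>i\<in>?I. (x i)\<^sup>2) \<le> \<rho>} \<inter> space ?P"
  have [measurable]: "B \<in> sets ?P" unfolding B_def by measurable
  have lL: "ennreal L * indicator B x \<le> l x" if x: "x \<in> space ?P" for x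
  proof (cases "x \<in> B")
    case True
    have "e x 0 \<bullet> k = 0"
      using k by (simp add: e_def inner_sum_left inner_Basis)
    moreover have "norm (e x 0) \<le> \<rho>"
    proof -
      have "(norm (e x 0))\<^sup>2 = (\<Sum>b\<in>?I. (x b)\<^sup>2)"
        using norm_slice_embedding[OF k, of x 0] by (simp add: e_def)
      then have "norm (e x 0) = sqrt (\<Sum>b\<in>?I. (x b)\<^sup>2)"
        by (metis norm_ge_zero real_sqrt_abs abs_of_nonneg)
      then show ?thesis using True by (simp add: B_def)
    qed
    ultimately obtain \<alpha> where \<alpha>: "\<And>s. \<alpha> < s \<and> s \<le> \<alpha> + L \<Longrightarrow> e x 0 + s *\<^sub>R k \<in> M"
      using thick by blast
    have "ennreal L = emeasure lborel {\<alpha> <.. \<alpha> + L}" using L by simp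
    also have "\<dots> \<le> l x" unfolding l_def
      using \<alpha> sl(3)[OF x] by (intro emeasure_mono) (auto simp: e_def)
    finally show ?thesis using True by simp
  qed simp
  have "ennreal (unit_ball_vol (real (card ?I)) * \<rho> ^ card ?I * L) = ennreal L * emeasure ?P B"
    unfolding B_def using emeasure_cball_aux[of ?I \<rho>] \<rho> L by (simp add: ennreal_mult'' mult.commute)
  also have "\<dots> = (\<integral>\<^sup>+x. ennreal L * indicator B x \<partial>?P)"
    by (rule nn_integral_cmult_indicator[symmetric]) measurable
  also have "\<dots> \<le> emeasure lborel M"
    unfolding sl(1) by (intro nn_integral_mono lL)
  finally show ?thesis by (simp add: card)
qed

lemma orthogonal_transformation_measurable:
  fixes T :: "'a::euclidean_space \<Rightarrow> 'a"
  assumes "orthogonal_transformation T"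
  shows "T \<in> borel_measurable borel"
  using orthogonal_transformation_linear[OF assms]
  by (intro borel_measurable_continuous_onI linear_continuous_on linear_conv_bounded_linear[THEN iffD1])

lemma rotate_to_Basis:
  fixes w :: "real ^ 'n"
  assumes "norm w = 1"
  shows "\<exists>T k. orthogonal_transformation T \<and> k \<in> (Basis :: (real ^ 'n) set) \<and> T k = w"
proof -
  obtain k :: "real ^ 'n" where k: "k \<in> Basis" using nonempty_Basis by blast
  then obtain T where "orthogonal_transformation T" "T k = w"
    using orthogonal_transformation_exists[of k w] assms by auto
  then show ?thesis using k by blast
qed

lemma emeasure_lborel_le_thin:
  fixes M :: "(real ^ 'n) set"
  assumes w: "norm w = 1" and M: "M \<in> sets borel" and D: "D \<ge> 0" and L: "L \<ge> 0"
    and diam: "\<And>x y. x \<in> M \<Longrightarrow> y \<in> M \<Longrightarrow> dist x y \<le> D"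
    and thin: "\<And>x u. x \<in> M \<Longrightarrow> x + u *\<^sub>R w \<in> M \<Longrightarrow> \<bar>u\<bar> \<le> L"
  shows "emeasure lborel M \<le> ennreal (unit_ball_vol (real (CARD('n) - 1)) * (D / 2) ^ (CARD('n) - 1) * L)"
proof -
  obtain T and k :: "real ^ 'n" where T: "orthogonal_transformation T" "k \<in> Basis" "T k = w" using rotate_to_Basis[OF w] by auto
  note [measurable] = orthogonal_transformation_measurable[OF T(1)]
  note lin = orthogonal_transformation_linear[OF T(1)]
  have "emeasure lborel M = emeasure lborel (T -` M)"
    by (subst lborel_distr_orthogonal[OF T(1), symmetric], subst emeasure_distr) (use M in auto)
  also have "\<dots> \<le> ennreal (unit_ball_vol (real (DIM(real ^ 'n) - 1)) * (D / 2) ^ (DIM(real ^ 'n) - 1) * L)"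
  proof (rule emeasure_lborel_le_Basis[OF T(2)])
    show "T -` M \<in> sets borel"
      using measurable_sets[of T borel borel M] M by simp
    fix x y assume "x \<in> T -` M" "y \<in> T -` M"
    then show "dist x y \<le> D" using diam[of "T x" "T y"] T(1)
      by (simp add: orthogonal_transformation_isometry)
  next
    fix x u assume "x \<in> T -` M" "x + u *\<^sub>R k \<in> T -` M"
    then show "\<bar>u\<bar> \<le> L" using thin[of "T x" u] T(3) by (simp add: linear_add[OF lin] linear_scale[OF lin])
  qed (use D L in auto)
  finally show ?thesis by simp
qed

lemma emeasure_lborel_ge_thick:
  fixes M :: "(real ^ 'n) set"
  assumes w: "norm w = 1" and M: "M \<in> sets borel" and \<rho>: "\<rho> > 0" and L: "L \<ge> 0"
    and thick: "\<And>v. v \<bullet> w = 0 \<Longrightarrow> norm v \<le> \<rho> \<Longrightarrow> \<exists>\<alpha>. \<forall>s. \<alpha> < s \<and> s \<le> \<alpha> + L \<longrightarrow> p + v + s *\<^sub>R w \<in> M"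
  shows "ennreal (unit_ball_vol (real (CARD('n) - 1)) * \<rho> ^ (CARD('n) - 1) * L) \<le> emeasure lborel M"
proof -
  obtain T and k :: "real ^ 'n" where T: "orthogonal_transformation T" "k \<in> Basis" "T k = w" using rotate_to_Basis[OF w] by auto
  note [measurable] = orthogonal_transformation_measurable[OF T(1)]
  note lin = orthogonal_transformation_linear[OF T(1)]
  let ?h = "\<lambda>x. p + T x"
  have "ennreal (unit_ball_vol (real (DIM(real ^ 'n) - 1)) * \<rho> ^ (DIM(real ^ 'n) - 1) * L) \<le> emeasure lborel (?h -` M)"
  proof (rule emeasure_lborel_ge_Basis[OF T(2)])
    show "?h -` M \<in> sets borel"
      using measurable_sets[of ?h borel borel M] M by simp
    fix v assume v: "v \<bullet> k = 0" "norm v \<le> \<rho>"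
    have "T v \<bullet> w = v \<bullet> k" using T(1) by (simp add: T(3)[symmetric] orthogonal_transformation_def)
    moreover have "norm (T v) = norm v" using T(1) by (simp add: orthogonal_transformation_norm)
    ultimately obtain \<alpha> where "\<forall>s. \<alpha> < s \<and> s \<le> \<alpha> + L \<longrightarrow> p + T v + s *\<^sub>R w \<in> M"
      using thick v by metis
    then show "\<exists>\<alpha>. \<forall>s. \<alpha> < s \<and> s \<le> \<alpha> + L \<longrightarrow> v + s *\<^sub>R k \<in> ?h -` M"
      by (intro exI[of _ \<alpha>]) (simp add: linear_add[OF lin] linear_scale[OF lin] T(3) add.assoc)
  qed (use \<rho> L in auto)
  also have "emeasure lborel (?h -` M) = emeasure lborel M"
  proof -
    have "emeasure lborel M = emeasure (distr (distr lborel borel T) borel ((+) p)) M"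
      by (simp add: lborel_distr_orthogonal[OF T(1)] lborel_distr_plus)
    also have "\<dots> = emeasure lborel (?h -` M)"
      by (subst distr_distr) (use M in \<open>auto simp: emeasure_distr o_def\<close>)
    finally show ?thesis by simp
  qed
  finally show ?thesis by simp
qed

text \<open>Between two points of \<open>C\<close> on a line in direction \<open>w\<close>,
  \<open>f\<close> changes at rate at least \<open>(1 - \<eta>) * norm w\<close>, which limits their
  distance if both are in the slab. As \<open>lin\<close> compares pairs of points and not
  derivatives along a segment, \<open>C\<close> can be far from convex.\<close>

lemma emeasure_slab_le:
  fixes f :: "real ^ 'n \<Rightarrow> real" and w :: "real ^ 'n"
  assumes w: "w \<noteq> 0" and \<eta>: "\<eta> < 1" and "a \<le> b"
    and f: "f \<in> borel_measurable borel" and C: "C \<in> sets borel" "bounded C"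
    and lin: "\<And>x y. x \<in> C \<Longrightarrow> y \<in> C \<Longrightarrow> \<bar>f y - f x - w \<bullet> (y - x)\<bar> \<le> \<eta> * norm w * norm (y - x)"
  shows "emeasure lborel (C \<inter> {x. a < f x \<and> f x \<le> b})
    \<le> ennreal (unit_ball_vol (real (CARD('n) - 1)) * (diameter C / 2) ^ (CARD('n) - 1) * ((b - a) / ((1 - \<eta>) * norm w)))"
proof (rule emeasure_lborel_le_thin)
  let ?w = "w /\<^sub>R norm w"
  show "norm ?w = 1" using w by simp
  show "C \<inter> {x. a < f x \<and> f x \<le> b} \<in> sets borel" using f C by measurable
  show "0 \<le> diameter C" using C by (simp add: diameter_ge_0)
  show "0 \<le> (b - a) / ((1 - \<eta>) * norm w)" using \<eta> \<open>a \<le> b\<close> by simp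
  fix x u assume *: "x \<in> C \<inter> {x. a < f x \<and> f x \<le> b}" "x + u *\<^sub>R ?w \<in> C \<inter> {x. a < f x \<and> f x \<le> b}"
  have "w \<bullet> (u *\<^sub>R ?w) = u * norm w" "norm (u *\<^sub>R ?w) = \<bar>u\<bar>"
    using w by (auto simp: dot_square_norm power2_eq_square abs_mult)
  then have "\<bar>f (x + u *\<^sub>R ?w) - f x - u * norm w\<bar> \<le> \<eta> * norm w * \<bar>u\<bar>"
    using lin[of x "x + u *\<^sub>R ?w"] * by (simp only: add_diff_cancel_left') auto
  moreover have "\<bar>f (x + u *\<^sub>R ?w) - f x\<bar> \<le> b - a" using * by auto
  ultimately have "\<bar>u * norm w\<bar> \<le> (b - a) + \<eta> * norm w * \<bar>u\<bar>" by linarith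
  then have "\<bar>u\<bar> * ((1 - \<eta>) * norm w) \<le> b - a"
    by (simp add: abs_mult algebra_simps)
  then show "\<bar>u\<bar> \<le> (b - a) / ((1 - \<eta>) * norm w)"
    using w \<eta> by (simp add: pos_le_divide_eq)
qed (use C in \<open>auto intro: diameter_bounded_bound\<close>)

text \<open>On every line in direction \<open>w\<close> meeting the inner disc, \<open>f\<close> climbs from below \<open>t - \<kappa>\<close> to above
  \<open>t + \<kappa>\<close> inside the ball, so the intermediate value theorem yields a full slice of the slab.\<close>
lemma emeasure_slab_ge:
  fixes f :: "real ^ 'n \<Rightarrow> real" and w p :: "real ^ 'n"
  assumes w: "w \<noteq> 0" and \<eta>: "0 < \<eta>" "\<eta> < 1" and r: "r > 0"
    and f: "continuous_on UNIV f"
    and lin: "\<And>x y. x \<in> cball p r \<Longrightarrow> y \<in> cball p r \<Longrightarrow>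
      \<bar>f y - f x - w \<bullet> (y - x)\<bar> \<le> \<eta> / 4 * norm w * norm (y - x)"
  obtains \<kappa> where "\<kappa> > 0"
    "\<And>a b. f p - \<kappa> < a \<Longrightarrow> a \<le> b \<Longrightarrow> b < f p + \<kappa> \<Longrightarrow>
      ennreal (unit_ball_vol (real (CARD('n) - 1)) * ((1 - \<eta>) * r) ^ (CARD('n) - 1) * ((b - a) / ((1 + \<eta>) * norm w)))
      \<le> emeasure lborel (cball p r \<inter> {x. a < f x \<and> f x \<le> b})"
proof -
  define u where "u = w /\<^sub>R norm w"
  have u: "norm u = 1" "w \<bullet> u = norm w" using w by (auto simp: u_def dot_square_norm power2_eq_square)
  have nw: "norm w > 0" using w by simp
  have wu: "w = norm w *\<^sub>R u" using w by (simp add: u_def)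
  \<comment> \<open>At the ends \<open>s = - \<eta> * r\<close> and \<open>s = \<eta> * r\<close> of
    a line the linear part is minus and plus four times \<kappa>, while the error
    \<open>\<eta> / 4\<close> relative to \<open>norm w\<close> costs at most \<kappa> over the
    radius \<open>r\<close>. So the ends clear the window with room to spare.\<close>
  define \<kappa> where "\<kappa> = norm w * r * \<eta> / 4"
  have \<kappa>: "\<kappa> > 0" using nw r \<eta> by (simp add: \<kappa>_def)
  have main: "ennreal (unit_ball_vol (real (CARD('n) - 1)) * ((1 - \<eta>) * r) ^ (CARD('n) - 1) * ((b - a) / ((1 + \<eta>) * norm w)))
      \<le> emeasure lborel (cball p r \<inter> {x. a < f x \<and> f x \<le> b})"
    if ab: "f p - \<kappa> < a" "a \<le> b" "b < f p + \<kappa>" for a b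
  proof (rule emeasure_lborel_ge_thick[OF u(1)])
    have "f \<in> borel_measurable borel" using f by (rule borel_measurable_continuous_onI)
    then show "cball p r \<inter> {x. a < f x \<and> f x \<le> b} \<in> sets borel" by measurable
    show "0 < (1 - \<eta>) * r" using \<eta> r by simp
    show "0 \<le> (b - a) / ((1 + \<eta>) * norm w)" using \<eta> ab by simp
    fix v assume v: "v \<bullet> u = 0" "norm v \<le> (1 - \<eta>) * r"
    define z where "z s = p + v + s *\<^sub>R u" for s
    have wv: "w \<bullet> v = 0" using v by (subst wu) (simp add: inner_commute)
    have in_ball: "z s \<in> cball p r" if s: "\<bar>s\<bar> \<le> \<eta> * r" for s
    proof -
      have "(norm (v + s *\<^sub>R u))\<^sup>2 = (norm v)\<^sup>2 + s\<^sup>2"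
        using u v by (simp add: power2_norm_eq_inner inner_add_left inner_add_right inner_commute[of u v] power2_eq_square[of s] norm_eq_1)
      also have "\<dots> \<le> ((1 - \<eta>) * r)\<^sup>2 + (\<eta> * r)\<^sup>2"
      proof (intro add_mono)
        show "(norm v)\<^sup>2 \<le> ((1 - \<eta>) * r)\<^sup>2" using v by (intro power_mono) auto
        show "s\<^sup>2 \<le> (\<eta> * r)\<^sup>2" using s by (simp add: abs_le_square_iff[symmetric] abs_mult \<eta> r less_imp_le)
      qed
      also have "\<dots> = r\<^sup>2 - 2 * \<eta> * (1 - \<eta>) * r\<^sup>2"
        by (simp add: power2_eq_square algebra_simps)
      also have "\<dots> \<le> r\<^sup>2"
      proof -
        have "0 \<le> 2 * \<eta> * (1 - \<eta>) * r\<^sup>2" using \<eta> by (intro mult_nonneg_nonneg) auto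
        then show ?thesis by linarith
      qed
      finally have "norm (v + s *\<^sub>R u) \<le> r" by (rule power2_le_imp_le) (use r in simp)
      moreover have "p - z s = - (v + s *\<^sub>R u)" by (simp add: z_def)
      ultimately show ?thesis by (simp only: mem_cball dist_norm norm_minus_cancel)
    qed
    have step: "\<bar>f (z s') - f (z s) - (s' - s) * norm w\<bar> \<le> \<eta> / 4 * norm w * \<bar>s' - s\<bar>"
      if "\<bar>s\<bar> \<le> \<eta> * r" "\<bar>s'\<bar> \<le> \<eta> * r" for s s'
    proof -
      have d: "z s' - z s = (s' - s) *\<^sub>R u" by (simp add: z_def algebra_simps)
      show ?thesis using lin[OF in_ball[OF that(1)] in_ball[OF that(2)]] by (simp add: d u)
    qed
    \<comment> \<open>Strict monotonicity along the line is what turns two crossing points into a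
      whole interval inside the slab.\<close>
    have strict: "f (z s) < f (z s')" if "\<bar>s\<bar> \<le> \<eta> * r" "\<bar>s'\<bar> \<le> \<eta> * r" "s < s'" for s s'
    proof -
      have "\<eta> / 4 * norm w * \<bar>s' - s\<bar> < 1 * norm w * \<bar>s' - s\<bar>"
        using that \<eta> nw by (intro mult_strict_right_mono) auto
      moreover have "\<bar>s' - s\<bar> = s' - s" using that by simp
      moreover have "(s' - s) * norm w = 1 * norm w * (s' - s)" by simp
      ultimately show ?thesis using step[OF that(1,2)] by (smt (verit))
    qed
    have base: "\<bar>f (z s) - f p - s * norm w\<bar> \<le> \<eta> / 4 * norm w * r" if "\<bar>s\<bar> \<le> \<eta> * r" for s
    proof -
      have "\<bar>f (z s) - f p - s * norm w\<bar> \<le> \<eta> / 4 * norm w * norm (z s - p)"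
        using lin[of p "z s"] in_ball[OF that] r by (simp add: z_def inner_add_right wv u)
      also have "\<dots> \<le> \<eta> / 4 * norm w * r"
        using in_ball[OF that] \<eta> by (intro mult_left_mono) (auto simp: dist_norm norm_minus_commute)
      finally show ?thesis .
    qed
    let ?s = "\<eta> * r"
    have s0: "?s > 0" using \<eta> r by simp
    have e: "\<eta> / 4 * norm w * r = \<kappa>" "?s * norm w = 4 * \<kappa>" "- ?s * norm w = - 4 * \<kappa>"
      by (simp_all add: \<kappa>_def)
    have lo: "f (z (- ?s)) \<le> f p - \<kappa>" using base[of "- ?s"] s0 \<kappa> unfolding e by simp
    have hi: "f p + \<kappa> \<le> f (z ?s)" using base[of "?s"] s0 \<kappa> unfolding e by simp
    have cont: "continuous_on {- ?s..?s} (\<lambda>s. f (z s))"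
      unfolding z_def by (intro continuous_on_compose2[OF f] continuous_intros) auto
    obtain sa where sa: "- ?s \<le> sa" "sa \<le> ?s" "f (z sa) = a"
      using IVT'[of "\<lambda>s. f (z s)" "- ?s" a ?s] lo hi ab s0 cont by auto
    obtain sb where sb: "- ?s \<le> sb" "sb \<le> ?s" "f (z sb) = b"
      using IVT'[of "\<lambda>s. f (z s)" "- ?s" b ?s] lo hi ab s0 cont by auto
    have sab: "sa \<le> sb" using strict[of sb sa] sa sb ab by (auto simp: abs_le_iff not_le[symmetric])
    have "b - a \<le> (1 + \<eta>) * norm w * (sb - sa)"
    proof -
      have "\<bar>b - a - (sb - sa) * norm w\<bar> \<le> \<eta> / 4 * norm w * (sb - sa)"
        using step[of sa sb] sa sb sab by simp
      then have "b - a \<le> (sb - sa) * norm w + \<eta> / 4 * norm w * (sb - sa)" by linarith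
      moreover have "\<eta> / 4 * norm w * (sb - sa) \<le> \<eta> * norm w * (sb - sa)"
        using sab \<eta> nw by (intro mult_right_mono) auto
      moreover have "(1 + \<eta>) * norm w * (sb - sa) = (sb - sa) * norm w + \<eta> * norm w * (sb - sa)"
        by (simp add: algebra_simps)
      ultimately show ?thesis by linarith
    qed
    then have "(b - a) / ((1 + \<eta>) * norm w) \<le> sb - sa"
      using \<eta> nw by (subst pos_divide_le_eq) (simp_all add: mult.commute)
    then have len: "sa + (b - a) / ((1 + \<eta>) * norm w) \<le> sb" by linarith
    show "\<exists>\<alpha>. \<forall>s. \<alpha> < s \<and> s \<le> \<alpha> + (b - a) / ((1 + \<eta>) * norm w) \<longrightarrow>
       p + v + s *\<^sub>R u \<in> cball p r \<inter> {x. a < f x \<and> f x \<le> b}"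
    proof (intro exI[of _ sa] allI impI)
      fix s assume s: "sa < s \<and> s \<le> sa + (b - a) / ((1 + \<eta>) * norm w)"
      then have "sa < s" "s \<le> sb" using len by auto
      moreover from this have "\<bar>s\<bar> \<le> ?s" using sa sb by auto
      moreover have "f (z s) \<le> b" using strict[of s sb] sb calculation by (cases "s = sb") (auto simp: abs_le_iff)
      ultimately show "p + v + s *\<^sub>R u \<in> cball p r \<inter> {x. a < f x \<and> f x \<le> b}"
        using strict[of sa s] sa in_ball[of s] by (auto simp: z_def)
    qed
  qed
  show thesis by (rule that[OF \<kappa> main])
qed

section \<open>Uniform linearization and Vitali covers\<close>

text \<open>Uniform continuity of \<open>df\<close> near the compact set makes \<delta> independent
  of \<open>p\<close>. The mean value inequality is applied to \<open>f\<close> minus its linear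
  part at \<open>p\<close>, so the error bound holds for all pairs in the ball and not only for
  pairs containing \<open>p\<close>.\<close>

lemma uniform_linear_approximation:
  fixes f :: "'a::euclidean_space \<Rightarrow> real" and df :: "'a \<Rightarrow> 'a \<Rightarrow>\<^sub>L real"
  assumes deriv: "\<And>x. (f has_derivative blinfun_apply (df x)) (at x)" and cont: "continuous_on UNIV df"
    and S: "compact S" and e: "e > 0"
  obtains \<delta> where "\<delta> > 0"
    "\<And>p x y. p \<in> S \<Longrightarrow> x \<in> cball p \<delta> \<Longrightarrow> y \<in> cball p \<delta> \<Longrightarrow>
      \<bar>f y - f x - df p (y - x)\<bar> \<le> e * norm (y - x)"
proof -
  let ?K = "{x + y |x y. x \<in> S \<and> y \<in> cball 0 1}"
  have K: "compact ?K" using S by (intro compact_sums) auto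
  have "uniformly_continuous_on ?K df"
    by (intro compact_uniformly_continuous continuous_on_subset[OF cont] K) auto
  then obtain d where d: "d > 0" "\<And>x y. x \<in> ?K \<Longrightarrow> y \<in> ?K \<Longrightarrow> dist y x < d \<Longrightarrow> dist (df y) (df x) < e"
    unfolding uniformly_continuous_on_def using e by (auto dest!: spec[of _ e])
  \<comment> \<open>The bound \<open>1\<close> keeps the balls inside \<open>?K\<close>;
    \<open>d / 2\<close> turns closed balls into distances strictly below \<open>d\<close>.\<close>
  show thesis
  proof (rule that[of "min 1 (d / 2)"])
    show "min 1 (d / 2) > 0" using d by simp
    fix p x y assume p: "p \<in> S" and xy: "x \<in> cball p (min 1 (d / 2))" "y \<in> cball p (min 1 (d / 2))"
    have K: "z \<in> ?K" if "z \<in> cball p (min 1 (d / 2))" for z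
    proof -
      have "dist p z \<le> 1" using that by simp
      then have "z - p \<in> cball 0 1" by (simp only: mem_cball dist_0_norm) (simp add: dist_norm norm_minus_commute)
      moreover have "z = p + (z - p)" by simp
      ultimately show ?thesis using p by blast
    qed
    have pK: "p \<in> ?K" by (rule K) (use d in simp)
    have "norm ((\<lambda>z. f z - df p z) y - (\<lambda>z. f z - df p z) x) \<le> e * norm (y - x)"
    proof (rule differentiable_bound[of "cball p (min 1 (d / 2))" _ "\<lambda>z. blinfun_apply (df z - df p)"])
      show "((\<lambda>z. f z - df p z) has_derivative blinfun_apply (df z - df p)) (at z within cball p (min 1 (d / 2)))" for z
        using has_derivative_diff[OF has_derivative_at_withinI[OF deriv]
            bounded_linear_imp_has_derivative[OF blinfun.bounded_linear_right]]
        by (simp add: blinfun.diff_left[abs_def])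
      fix z assume z: "z \<in> cball p (min 1 (d / 2))"
      have "dist (df z) (df p) < e" using d(2)[OF pK K[OF z]] z d(1) by (auto simp: dist_commute)
      then show "onorm (blinfun_apply (df z - df p)) \<le> e"
        by (simp add: norm_blinfun.rep_eq[symmetric] dist_norm)
    qed (use xy in auto)
    then show "\<bar>f y - f x - df p (y - x)\<bar> \<le> e * norm (y - x)" by (simp add: blinfun.diff_right algebra_simps)
  qed
qed

text \<open>The tail \<open>G\<close> of the Vitali family has small total weight, so only \<open>F\<close> matters.\<close>
lemma finite_Vitali_cover:
  fixes S :: "'a::euclidean_space set"
  assumes S: "compact S" and \<delta>: "\<delta> > 0" and \<zeta>: "\<zeta> > 0" and \<tau>: "\<tau> > 0"
    and bound: "\<And>F. finite F \<Longrightarrow> F \<subseteq> S \<times> {0<..<\<delta>} \<Longrightarrow>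
      pairwise (\<lambda>i j. disjnt (cball (fst i) (snd i)) (cball (fst j) (snd j))) F \<Longrightarrow> (\<Sum>i\<in>F. snd i ^ d) \<le> B"
  obtains F G where "finite F" "F \<subseteq> S \<times> {0<..<\<delta>}" "finite G" "G \<subseteq> S \<times> {0<..<\<delta>}"
    "pairwise (\<lambda>i j. disjnt (cball (fst i) (snd i)) (cball (fst j) (snd j))) F"
    "S \<subseteq> (\<Union>i\<in>F. ball (fst i) ((1 + \<zeta>) * snd i)) \<union> (\<Union>i\<in>G. ball (fst i) (5 * snd i))"
    "(\<Sum>i\<in>G. snd i ^ d) \<le> \<tau>"
proof -
  let ?K = "S \<times> {0<..<\<delta>}"
  have pos: "\<And>i. i \<in> ?K \<Longrightarrow> 0 < snd i \<and> snd i \<le> \<delta>" by auto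
  obtain C where C: "countable C" "C \<subseteq> ?K"
    "pairwise (\<lambda>i j. disjnt (cball (fst i) (snd i)) (cball (fst j) (snd j))) C"
    and cov: "\<And>i. i \<in> ?K \<Longrightarrow> \<exists>j. j \<in> C \<and> \<not> disjnt (cball (fst i) (snd i)) (cball (fst j) (snd j)) \<and>
      cball (fst i) (snd i) \<subseteq> ball (fst j) (5 * snd j)"
    by (rule Vitali_covering_lemma_cballs_balls[where K = ?K and r = snd and a = fst and B = \<delta>, OF pos]) (blast intro: that)+
  have bd: "(\<Sum>i\<in>F. snd i ^ d) \<le> B" if "finite F" "F \<subseteq> C" for F
    using that C by (intro bound pairwise_subset[OF C(3)]) auto
  have "(\<lambda>i. snd i ^ d) summable_on C"
  proof (rule nonneg_bdd_above_summable_on)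
    show "bdd_above (sum (\<lambda>i. snd i ^ d) ` {F. F \<subseteq> C \<and> finite F})"
      using bd by (intro bdd_aboveI[of _ B]) auto
    show "0 \<le> snd i ^ d" if "i \<in> C" for i using that C by auto
  qed
  then have "((\<lambda>i. snd i ^ d) has_sum infsum (\<lambda>i. snd i ^ d) C) C" by simp
  then have "\<forall>\<^sub>F F in finite_subsets_at_top C. dist (\<Sum>i\<in>F. snd i ^ d) (infsum (\<lambda>i. snd i ^ d) C) < \<tau> / 2"
    unfolding has_sum_def using \<tau> by (intro tendstoD) auto
  then obtain F where F: "finite F" "F \<subseteq> C"
    "\<And>F'. finite F' \<Longrightarrow> F \<subseteq> F' \<Longrightarrow> F' \<subseteq> C \<Longrightarrow> dist (\<Sum>i\<in>F'. snd i ^ d) (infsum (\<lambda>i. snd i ^ d) C) < \<tau> / 2"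
    unfolding eventually_finite_subsets_at_top by auto
  have tail: "(\<Sum>i\<in>G. snd i ^ d) \<le> \<tau>" if G: "finite G" "G \<subseteq> C - F" for G
  proof -
    have "(\<Sum>i\<in>F \<union> G. snd i ^ d) = (\<Sum>i\<in>F. snd i ^ d) + (\<Sum>i\<in>G. snd i ^ d)"
      using F G by (intro sum.union_disjoint) auto
    moreover have "dist (\<Sum>i\<in>F \<union> G. snd i ^ d) (infsum (\<lambda>i. snd i ^ d) C) < \<tau> / 2"
      "dist (\<Sum>i\<in>F. snd i ^ d) (infsum (\<lambda>i. snd i ^ d) C) < \<tau> / 2"
    proof -
      show "dist (\<Sum>i\<in>F \<union> G. snd i ^ d) (infsum (\<lambda>i. snd i ^ d) C) < \<tau> / 2"
        by (rule F(3)) (use F(1,2) G in blast)+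
      show "dist (\<Sum>i\<in>F. snd i ^ d) (infsum (\<lambda>i. snd i ^ d) C) < \<tau> / 2"
        by (rule F(3)) (use F(1,2) in blast)+
    qed
    ultimately show ?thesis unfolding dist_real_def by linarith
  qed
  have open_cover: "S \<subseteq> (\<Union>i\<in>F. ball (fst i) ((1 + \<zeta>) * snd i)) \<union> (\<Union>i\<in>C - F. ball (fst i) (5 * snd i))"
  proof
    fix x assume x: "x \<in> S"
    show "x \<in> (\<Union>i\<in>F. ball (fst i) ((1 + \<zeta>) * snd i)) \<union> (\<Union>i\<in>C - F. ball (fst i) (5 * snd i))"
    proof (cases "x \<in> (\<Union>i\<in>F. cball (fst i) (snd i))")
      case True
      then obtain i where i: "i \<in> F" "x \<in> cball (fst i) (snd i)" by blast
      then have "snd i > 0" using F C by auto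
      then have "snd i < (1 + \<zeta>) * snd i" using \<zeta> by simp
      then show ?thesis using i by force
    next
      case False
      \<comment> \<open>A tiny ball around \<open>x\<close> avoids the balls of \<open>F\<close>.
        The member of the Vitali family that meets it is therefore in the tail, and its fivefold
        enlargement contains \<open>x\<close>.\<close>
      have "open (- (\<Union>i\<in>F. cball (fst i) (snd i)))" using F(1) by (intro open_Compl closed_UN) auto
      then obtain r where r: "r > 0" "ball x r \<subseteq> - (\<Union>i\<in>F. cball (fst i) (snd i))"
        using False by (meson ComplI openE)
      define \<rho> where "\<rho> = min (r / 2) (\<delta> / 2)"
      have "0 < \<rho>" "\<rho> < \<delta>" "\<rho> < r" using r(1) \<delta> by (auto simp: \<rho>_def min_def)
      then have \<rho>: "(x, \<rho>) \<in> ?K" "cball x \<rho> \<subseteq> ball x r" "x \<in> cball x \<rho>" using x by auto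
      then obtain j where j: "j \<in> C" "\<not> disjnt (cball x \<rho>) (cball (fst j) (snd j))" "cball x \<rho> \<subseteq> ball (fst j) (5 * snd j)"
        using cov[OF \<rho>(1)] by auto
      then have "j \<notin> F" using r(2) \<rho>(2) unfolding disjnt_def by blast
      then show ?thesis using j \<rho>(3) by blast
    qed
  qed
  \<comment> \<open>Replacing the closed balls of \<open>F\<close> by slightly larger open ones
    leaves a compact remainder. The finite \<open>G\<close> may depend on \<open>F\<close>, because
    \<open>tail\<close> bounds every finite part of \<open>C - F\<close>.\<close>
  let ?U = "\<Union>i\<in>F. ball (fst i) ((1 + \<zeta>) * snd i)"
  have "compact (S - ?U)" using S by (rule compact_diff) auto
  moreover have "\<And>i. i \<in> C - F \<Longrightarrow> open (ball (fst i) (5 * snd i))" by simp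
  moreover have "S - ?U \<subseteq> (\<Union>i\<in>C - F. ball (fst i) (5 * snd i))" using open_cover by blast
  ultimately obtain G where G: "G \<subseteq> C - F" "finite G" "S - ?U \<subseteq> (\<Union>i\<in>G. ball (fst i) (5 * snd i))"
    by (rule compactE_image)
  show thesis
  proof (rule that[of F G])
    show "S \<subseteq> (\<Union>i\<in>F. ball (fst i) ((1 + \<zeta>) * snd i)) \<union> (\<Union>i\<in>G. ball (fst i) (5 * snd i))"
      using G(3) by blast
    show "pairwise (\<lambda>i j. disjnt (cball (fst i) (snd i)) (cball (fst j) (snd j))) F"
      using C(3) F(2) by (rule pairwise_subset)
    show "F \<subseteq> S \<times> {0<..<\<delta>}" "G \<subseteq> S \<times> {0<..<\<delta>}" using F(2) G(1) C(2) by blast+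
    show "(\<Sum>i\<in>G. snd i ^ d) \<le> \<tau>" using G by (intro tail)
  qed (use F(1) G(2) in auto)
qed

subsection \<open>The rate of growth of the sublevel volume\<close>

text \<open>Riesz representation: it links \<open>gradient\<close>, in which the result is phrased,
  to the continuous map \<open>df\<close>, whose operator norm is thus the gradient norm.\<close>

lemma gradient_facts:
  fixes f :: "'a::euclidean_space \<Rightarrow> real"
  assumes "(f has_derivative blinfun_apply D) (at x)"
  shows "gradient f x \<bullet> v = D v" and "norm (gradient f x) = norm D"
proof -
  define w where "w = (\<Sum>b\<in>Basis. D b *\<^sub>R b)"
  have w: "v \<bullet> w = D v" for v
  proof -
    have "D v = D (\<Sum>b\<in>Basis. (v \<bullet> b) *\<^sub>R b)" by (simp add: euclidean_representation)
    then show ?thesis by (simp add: w_def blinfun.sum_right blinfun.scaleR_right inner_sum_right mult.commute)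
  qed
  have g: "GDERIV f x :> w" using assms by (simp add: gderiv_def w)
  have "gradient f x = w"
    unfolding gradient_def
  proof (rule the_equality, rule g)
    fix w' assume "GDERIV f x :> w'"
    then have "(\<lambda>h. h \<bullet> w') = (\<lambda>h. h \<bullet> w)"
      using g has_derivative_unique unfolding gderiv_def by blast
    then have "h \<bullet> (w' - w) = 0" for h by (simp add: inner_diff_right fun_eq_iff)
    then show "w' = w" by (metis inner_eq_zero_iff right_minus_eq)
  qed
  then show e: "gradient f x \<bullet> v = D v" for v using w by (simp add: inner_commute)
  show "norm (gradient f x) = norm D"
  proof (rule antisym)
    have "norm (gradient f x) * norm (gradient f x) = D (gradient f x)"
      using e[of "gradient f x"] by (simp add: dot_square_norm power2_eq_square)
    also have "\<dots> \<le> norm D * norm (gradient f x)" using norm_blinfun[of D "gradient f x"] by simp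
    finally show "norm (gradient f x) \<le> norm D" by (cases "norm (gradient f x) = 0") auto
    show "norm D \<le> norm (gradient f x)"
      by (rule norm_blinfun_bound) (auto simp: e[symmetric] Cauchy_Schwarz_ineq2)
  qed
qed

section \<open>Slabs over small windows near the regular value\<close>

text \<open>A window has to be near \<open>t\<close> but need not contain it. Convergence along this
  filter is strict differentiability at \<open>t\<close>, so both one-sided quotients are covered at
  once.\<close>

definition shrinking_windows :: "real \<Rightarrow> (real \<times> real) filter" where
  "shrinking_windows t = (INF \<kappa>\<in>{0<..}. principal {(a, b). t - \<kappa> < a \<and> a < b \<and> b < t + \<kappa>})"

lemma eventually_shrinking_windows:
  "eventually P (shrinking_windows t) \<longleftrightarrow>
    (\<exists>\<kappa>>0. \<forall>a b. t - \<kappa> < a \<and> a < b \<and> b < t + \<kappa> \<longrightarrow> P (a, b))"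
proof -
  have "eventually P (shrinking_windows t) \<longleftrightarrow>
    (\<exists>\<kappa>\<in>{0<..}. eventually P (principal {(a, b). t - \<kappa> < a \<and> a < b \<and> b < t + \<kappa>}))"
    unfolding shrinking_windows_def
  proof (rule eventually_INF_base)
    fix x y :: real assume "x \<in> {0<..}" "y \<in> {0<..}"
    then show "\<exists>z\<in>{0<..}. principal {(a, b). t - z < a \<and> a < b \<and> b < t + z} \<le>
      inf (principal {(a, b). t - x < a \<and> a < b \<and> b < t + x}) (principal {(a, b). t - y < a \<and> a < b \<and> b < t + y})"
      by (intro bexI[of _ "min x y"]) auto
  qed auto
  then show ?thesis by (auto simp: eventually_principal)
qed

lemma shrinking_windows_neq_bot: "shrinking_windows t \<noteq> bot"
proof
  assume "shrinking_windows t = bot"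
  then have "eventually (\<lambda>_. False) (shrinking_windows t)" by simp
  then obtain \<kappa> where "\<kappa> > 0" "\<forall>a b. \<not> (t - \<kappa> < a \<and> a < b \<and> b < t + \<kappa>)"
    by (auto simp: eventually_shrinking_windows)
  then show False using spec[of _ t] by (metis diff_less_eq dense less_add_same_cancel1)
qed

text \<open>This is the setting for a single value \<open>t\<close>. Compact sublevel sets give a
  compact fibre and slabs of finite volume; \<open>nonempty\<close> makes the extrema of the
  gradient norm on the fibre meaningful.\<close>

locale regular_level =
  fixes f :: "real ^ 'n \<Rightarrow> real" and df :: "real ^ 'n \<Rightarrow> (real ^ 'n) \<Rightarrow>\<^sub>L real" and t :: real and d :: nat
  assumes d_eq: "d = CARD('n) - 1"
    and deriv: "\<And>x. (f has_derivative blinfun_apply (df x)) (at x)"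
    and cont_df: "continuous_on UNIV df"
    and compact_sublevel: "\<And>s. compact {x. f x \<le> s}"
    and regular: "\<And>x. f x = t \<Longrightarrow> df x \<noteq> 0"
    and nonempty: "\<exists>x. f x = t"
begin

abbreviation "\<omega> \<equiv> unit_ball_vol (real d)"
definition "fibre = {x. f x = t}"
definition "grad_norm p = norm (df p)"
definition "slab a b = {x. a < f x \<and> f x \<le> b}"
definition "slab_rate = (\<lambda>(a, b). measure lborel (slab a b) / (b - a))"

lemma continuous_f: "continuous_on A f"
  using deriv by (intro continuous_at_imp_continuous_on ballI has_derivative_continuous) blast

lemma f_borel [measurable]: "f \<in> borel_measurable borel"
  by (rule borel_measurable_continuous_onI[OF continuous_f])

lemma slab_borel [measurable]: "slab a b \<in> sets borel"
  unfolding slab_def by measurable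

lemma bounded_slab: "bounded (slab a b)"
  by (rule bounded_subset[OF compact_imp_bounded[OF compact_sublevel[of b]]]) (auto simp: slab_def)

lemma fmeasurable_slab: "slab a b \<in> fmeasurable lborel"
  using emeasure_bounded_finite[OF bounded_slab] by (intro fmeasurableI) auto

lemma compact_fibre: "compact fibre"
proof -
  have "closed {x. f x = t}" by (intro closed_Collect_eq continuous_f continuous_intros)
  then have "compact ({x. f x \<le> t} \<inter> {x. f x = t})" using compact_sublevel by (rule compact_Int_closed[rotated])
  then show ?thesis by (simp add: fibre_def Int_def conj_commute cong: conj_cong)
qed

lemma fibre_nonempty: "fibre \<noteq> {}" using nonempty by (auto simp: fibre_def)

lemma grad_norm_pos: "p \<in> fibre \<Longrightarrow> grad_norm p > 0" using regular by (auto simp: fibre_def grad_norm_def)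

lemma continuous_grad_norm: "continuous_on A grad_norm"
  unfolding grad_norm_def by (intro continuous_intros continuous_on_subset[OF cont_df]) auto

definition "grad_min = Inf (grad_norm ` fibre)"
definition "grad_max = Sup (grad_norm ` fibre)"

lemma grad_norm_bounds:
  shows grad_min_le: "p \<in> fibre \<Longrightarrow> grad_min \<le> grad_norm p" and le_grad_max: "p \<in> fibre \<Longrightarrow> grad_norm p \<le> grad_max" and grad_min_pos: "0 < grad_min"
    and grad_min_attained: "\<exists>p\<in>fibre. grad_norm p = grad_min" and grad_max_attained: "\<exists>p\<in>fibre. grad_norm p = grad_max"
proof -
  have c: "compact (grad_norm ` fibre)" by (intro compact_continuous_image continuous_grad_norm compact_fibre)
  have ne: "grad_norm ` fibre \<noteq> {}" using fibre_nonempty by simp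
  show *: "\<exists>p\<in>fibre. grad_norm p = grad_min" "\<exists>p\<in>fibre. grad_norm p = grad_max"
    using closed_contains_Inf[OF ne bounded_imp_bdd_below[OF compact_imp_bounded[OF c]] compact_imp_closed[OF c]]
      closed_contains_Sup[OF ne bounded_imp_bdd_above[OF compact_imp_bounded[OF c]] compact_imp_closed[OF c]]
    by (force simp: grad_min_def grad_max_def)+
  show "p \<in> fibre \<Longrightarrow> grad_min \<le> grad_norm p" "p \<in> fibre \<Longrightarrow> grad_norm p \<le> grad_max"
    unfolding grad_min_def grad_max_def
    using bounded_imp_bdd_below[OF compact_imp_bounded[OF c]] bounded_imp_bdd_above[OF compact_imp_bounded[OF c]]
    by (auto intro: cInf_lower cSup_upper)
  show "0 < grad_min" using *(1) grad_norm_pos by metis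
qed

lemma omega_pos: "\<omega> > 0" by simp

text \<open>By compactness the gradient norm on the fibre is at least \<open>grad_min > 0\<close>,
  so the absolute error \<open>e * grad_min\<close> is a relative error of at most \<open>e\<close>
  at every point.\<close>

lemma linear_approximation_scale:
  assumes "0 < e"
  obtains \<delta> where "\<delta> > 0"
    "\<And>p x y. p \<in> fibre \<Longrightarrow> x \<in> cball p \<delta> \<Longrightarrow> y \<in> cball p \<delta> \<Longrightarrow>
      \<bar>f y - f x - gradient f p \<bullet> (y - x)\<bar> \<le> e * norm (gradient f p) * norm (y - x)"
proof -
  obtain \<delta> where \<delta>: "\<delta> > 0"
    "\<And>p x y. p \<in> fibre \<Longrightarrow> x \<in> cball p \<delta> \<Longrightarrow> y \<in> cball p \<delta> \<Longrightarrow> \<bar>f y - f x - df p (y - x)\<bar> \<le> e * grad_min * norm (y - x)"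
    using uniform_linear_approximation[OF deriv cont_df compact_fibre, of "e * grad_min"] assms grad_min_pos by auto
  show thesis
  proof (rule that[OF \<delta>(1)])
    fix p x y assume *: "p \<in> fibre" "x \<in> cball p \<delta>" "y \<in> cball p \<delta>"
    have "e * grad_min * norm (y - x) \<le> e * grad_norm p * norm (y - x)"
      using grad_min_le[OF *(1)] assms by (intro mult_right_mono mult_left_mono) auto
    then show "\<bar>f y - f x - gradient f p \<bullet> (y - x)\<bar> \<le> e * norm (gradient f p) * norm (y - x)"
      using \<delta>(2)[OF *] by (simp add: gradient_facts[OF deriv] grad_norm_def)
  qed
qed

lemma slab_upper:
  assumes \<eta>: "0 < \<eta>" "\<eta> < 1"
  obtains \<delta> where "\<delta> > 0"
    "\<And>p C a b. p \<in> fibre \<Longrightarrow> p \<in> C \<Longrightarrow> C \<in> sets borel \<Longrightarrow> bounded C \<Longrightarrow> diameter C \<le> \<delta> \<Longrightarrow> a \<le> b \<Longrightarrow>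
      measure lborel (C \<inter> slab a b) \<le> \<omega> * (diameter C / 2) ^ d * ((b - a) / ((1 - \<eta>) * grad_norm p))"
proof -
  obtain \<delta> where \<delta>: "\<delta> > 0"
    "\<And>p x y. p \<in> fibre \<Longrightarrow> x \<in> cball p \<delta> \<Longrightarrow> y \<in> cball p \<delta> \<Longrightarrow>
      \<bar>f y - f x - gradient f p \<bullet> (y - x)\<bar> \<le> \<eta> * norm (gradient f p) * norm (y - x)"
    using linear_approximation_scale[OF \<eta>(1)] by blast
  show thesis
  proof (rule that[OF \<delta>(1)])
    fix p C a b assume *: "p \<in> fibre" "p \<in> C" "C \<in> sets borel" "bounded C" "diameter C \<le> \<delta>" "a \<le> (b::real)"
    have C: "x \<in> cball p \<delta>" if "x \<in> C" for x
      using diameter_bounded_bound[OF *(4,2) that] *(5) by simp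
    have grad_norm: "norm (gradient f p) = grad_norm p" by (simp add: gradient_facts[OF deriv] grad_norm_def)
    have "emeasure lborel (C \<inter> {x. a < f x \<and> f x \<le> b})
      \<le> ennreal (\<omega> * (diameter C / 2) ^ d * ((b - a) / ((1 - \<eta>) * norm (gradient f p))))"
      unfolding d_eq
      by (rule emeasure_slab_le[OF _ \<eta>(2) *(6) f_borel *(3,4)])
        (use grad_norm grad_norm_pos[OF *(1)] \<delta>(2)[OF *(1) C C] in auto)
    then have "emeasure lborel (C \<inter> slab a b) \<le> ennreal (\<omega> * (diameter C / 2) ^ d * ((b - a) / ((1 - \<eta>) * grad_norm p)))"
      by (simp only: slab_def grad_norm)
    then show "measure lborel (C \<inter> slab a b) \<le> \<omega> * (diameter C / 2) ^ d * ((b - a) / ((1 - \<eta>) * grad_norm p))"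
      unfolding measure_def using *(6) \<eta> grad_norm_pos[OF *(1)] diameter_ge_0[OF *(4)]
      by (intro enn2real_leI) (auto intro!: mult_nonneg_nonneg divide_nonneg_nonneg)
  qed
qed

text \<open>The radius threshold \<delta> is uniform on the fibre, but the admissible window depends
  on \<open>p\<close> and \<open>r\<close>. The filter absorbs this dependence when finitely many
  balls are used together.\<close>

lemma slab_lower:
  assumes \<eta>: "0 < \<eta>" "\<eta> < 1"
  obtains \<delta> where "\<delta> > 0"
    "\<And>p r. p \<in> fibre \<Longrightarrow> 0 < r \<Longrightarrow> r < \<delta> \<Longrightarrow> \<forall>\<^sub>F (a, b) in shrinking_windows t.
      \<omega> * ((1 - \<eta>) * r) ^ d * ((b - a) / ((1 + \<eta>) * grad_norm p)) \<le> measure lborel (cball p r \<inter> slab a b)"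
proof -
  obtain \<delta> where \<delta>: "\<delta> > 0"
    "\<And>p x y. p \<in> fibre \<Longrightarrow> x \<in> cball p \<delta> \<Longrightarrow> y \<in> cball p \<delta> \<Longrightarrow>
      \<bar>f y - f x - gradient f p \<bullet> (y - x)\<bar> \<le> \<eta> / 4 * norm (gradient f p) * norm (y - x)"
    using linear_approximation_scale[of "\<eta> / 4"] \<eta> by auto
  show thesis
  proof (rule that[OF \<delta>(1)])
    fix p r assume *: "p \<in> fibre" "0 < r" "r < \<delta>"
    have grad_norm: "norm (gradient f p) = grad_norm p" by (simp add: gradient_facts[OF deriv] grad_norm_def)
    have ne: "gradient f p \<noteq> 0" using grad_norm grad_norm_pos[OF *(1)] by auto
    have sub: "x \<in> cball p \<delta>" if "x \<in> cball p r" for x using that *(3) by auto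
    obtain \<kappa> where \<kappa>: "\<kappa> > 0"
      "\<And>a b. f p - \<kappa> < a \<Longrightarrow> a \<le> b \<Longrightarrow> b < f p + \<kappa> \<Longrightarrow>
        ennreal (\<omega> * ((1 - \<eta>) * r) ^ d * ((b - a) / ((1 + \<eta>) * norm (gradient f p))))
        \<le> emeasure lborel (cball p r \<inter> {x. a < f x \<and> f x \<le> b})"
      using emeasure_slab_ge[OF ne \<eta> *(2) continuous_f \<delta>(2)[OF *(1) sub sub], folded d_eq] by blast
    show "\<forall>\<^sub>F (a, b) in shrinking_windows t.
      \<omega> * ((1 - \<eta>) * r) ^ d * ((b - a) / ((1 + \<eta>) * grad_norm p)) \<le> measure lborel (cball p r \<inter> slab a b)"
      unfolding eventually_shrinking_windows
    proof (intro exI[of _ \<kappa>] conjI allI impI)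
      fix a b assume ab: "t - \<kappa> < a \<and> a < b \<and> b < t + \<kappa>"
      have "ennreal (\<omega> * ((1 - \<eta>) * r) ^ d * ((b - a) / ((1 + \<eta>) * grad_norm p))) \<le> emeasure lborel (cball p r \<inter> slab a b)"
        using \<kappa>(2)[of a b] ab *(1) unfolding grad_norm slab_def fibre_def by simp
      moreover have "emeasure lborel (cball p r \<inter> slab a b) = ennreal (measure lborel (cball p r \<inter> slab a b))"
        by (intro emeasure_eq_ennreal_measure less_imp_neq[OF order_le_less_trans[OF _ emeasure_bounded_finite[OF bounded_slab, of a b], unfolded infinity_ennreal_def]] emeasure_mono) auto
      ultimately show "case (a, b) of (a, b) \<Rightarrow>
        \<omega> * ((1 - \<eta>) * r) ^ d * ((b - a) / ((1 + \<eta>) * grad_norm p)) \<le> measure lborel (cball p r \<inter> slab a b)"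
        by (simp add: ennreal_le_iff)
    qed (rule \<kappa>(1))
  qed
qed

text \<open>Outside \<open>U\<close>, on the compact sublevel set at \<open>t + 1\<close>,
  \<open>f\<close> keeps a positive distance from \<open>t\<close>. This is how a cover of the fibre
  becomes a cover of all sufficiently thin slabs.\<close>

lemma slab_in_open:
  assumes "open U" "fibre \<subseteq> U"
  shows "\<forall>\<^sub>F (a, b) in shrinking_windows t. slab a b \<subseteq> U"
proof -
  let ?K = "{x. f x \<le> t + 1} - U"
  have K: "compact ?K" using compact_sublevel assms(1) by (rule compact_diff)
  have "\<exists>\<kappa>>0. \<forall>x\<in>?K. \<kappa> \<le> \<bar>f x - t\<bar>"
  proof (cases "?K = {}")
    case False
    have "continuous_on ?K (\<lambda>x. \<bar>f x - t\<bar>)" by (intro continuous_intros continuous_f)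
    from continuous_attains_inf[OF K False this]
    obtain x where x: "x \<in> ?K" "\<And>y. y \<in> ?K \<Longrightarrow> \<bar>f x - t\<bar> \<le> \<bar>f y - t\<bar>" by blast
    then have "\<bar>f x - t\<bar> > 0" using assms(2) by (auto simp: fibre_def)
    then show ?thesis using x(2) by blast
  qed (auto intro: exI[of _ 1])
  then obtain \<kappa> where \<kappa>: "\<kappa> > 0" "\<And>x. x \<in> ?K \<Longrightarrow> \<kappa> \<le> \<bar>f x - t\<bar>" by blast
  show ?thesis unfolding eventually_shrinking_windows
  proof (intro exI[of _ "min 1 \<kappa>"] conjI allI impI)
    show "0 < min 1 \<kappa>" using \<kappa> by simp
    fix a b assume ab: "t - min 1 \<kappa> < a \<and> a < b \<and> b < t + min 1 \<kappa>"
    have "x \<in> U" if "a < f x" "f x \<le> b" for x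
    proof (rule ccontr)
      assume "x \<notin> U"
      then have "\<kappa> \<le> \<bar>f x - t\<bar>" using that ab by (intro \<kappa>(2)) auto
      moreover have "t - \<kappa> < a" "b < t + \<kappa>" using ab by auto
      ultimately show False using that by linarith
    qed
    then show "case (a, b) of (a, b) \<Rightarrow> slab a b \<subseteq> U" by (auto simp: slab_def)
  qed
qed

lemma eventually_window_less: "\<forall>\<^sub>F (a, b) in shrinking_windows t. a < b"
  unfolding eventually_shrinking_windows by (intro exI[of _ 1]) auto

text \<open>Subadditivity over a finite open cover. The index type stays free because it is used for
  points, for a disjoint sum of two families of balls, and for natural numbers.\<close>

lemma slab_rate_upper:
  assumes \<eta>: "0 < \<eta>" "\<eta> < 1"
  obtains \<delta> where "\<delta> > 0"
    "\<And>I C p. finite I \<Longrightarrow> (\<And>i. i \<in> I \<Longrightarrow> open (C i) \<and> bounded (C i) \<and> diameter (C i) \<le> \<delta> \<and> p i \<in> fibre \<inter> C i) \<Longrightarrow>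
      fibre \<subseteq> (\<Union>i\<in>I. C i) \<Longrightarrow>
      \<forall>\<^sub>F z in shrinking_windows t. slab_rate z \<le> (\<Sum>i\<in>I. \<omega> * (diameter (C i) / 2) ^ d / grad_norm (p i)) / (1 - \<eta>)"
proof -
  obtain \<delta> where \<delta>: "\<delta> > 0"
    "\<And>p C a b. p \<in> fibre \<Longrightarrow> p \<in> C \<Longrightarrow> C \<in> sets borel \<Longrightarrow> bounded C \<Longrightarrow> diameter C \<le> \<delta> \<Longrightarrow> a \<le> b \<Longrightarrow>
      measure lborel (C \<inter> slab a b) \<le> \<omega> * (diameter C / 2) ^ d * ((b - a) / ((1 - \<eta>) * grad_norm p))"
    using slab_upper[OF \<eta>] by blast
  show thesis
  proof (rule that[OF \<delta>(1)])
    fix I :: "'i set" and C p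
    assume I: "finite I" and C: "\<And>i. i \<in> I \<Longrightarrow> open (C i) \<and> bounded (C i) \<and> diameter (C i) \<le> \<delta> \<and> p i \<in> fibre \<inter> C i"
      and cover: "fibre \<subseteq> (\<Union>i\<in>I. C i)"
    have "open (\<Union>i\<in>I. C i)" using C by auto
    from slab_in_open[OF this cover] eventually_window_less
    show "\<forall>\<^sub>F z in shrinking_windows t. slab_rate z \<le> (\<Sum>i\<in>I. \<omega> * (diameter (C i) / 2) ^ d / grad_norm (p i)) / (1 - \<eta>)"
    proof eventually_elim
      case (elim z)
      obtain a b where z: "z = (a, b)" by (cases z)
      with elim have sub: "slab a b \<subseteq> (\<Union>i\<in>I. C i)" and ab: "a < b" by auto
      have [measurable]: "C i \<in> sets borel" if "i \<in> I" for i using C[OF that] by auto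
      have "slab a b = (\<Union>i\<in>I. C i \<inter> slab a b)" using sub by auto
      then have "measure lborel (slab a b) = measure lborel (\<Union>i\<in>I. C i \<inter> slab a b)" by simp
      also have "\<dots> \<le> (\<Sum>i\<in>I. measure lborel (C i \<inter> slab a b))"
        by (intro measure_UNION_le I) auto
      also have "\<dots> \<le> (\<Sum>i\<in>I. \<omega> * (diameter (C i) / 2) ^ d * ((b - a) / ((1 - \<eta>) * grad_norm (p i))))"
        using C ab by (intro sum_mono \<delta>(2)) auto
      also have "\<dots> = (b - a) * ((\<Sum>i\<in>I. \<omega> * (diameter (C i) / 2) ^ d / grad_norm (p i)) / (1 - \<eta>))"
        by (simp add: sum_distrib_left sum_divide_distrib mult_ac)
      finally show ?case using ab by (simp add: z slab_rate_def pos_divide_le_eq mult.commute)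
    qed
  qed
qed

text \<open>Disjointness lets the estimates for single balls add up to at most the volume of the
  slab; finiteness makes one window serve all of them.\<close>

lemma slab_rate_lower:
  assumes \<eta>: "0 < \<eta>" "\<eta> < 1"
  obtains \<delta> where "\<delta> > 0"
    "\<And>F. finite F \<Longrightarrow> F \<subseteq> fibre \<times> {0<..<\<delta>} \<Longrightarrow>
      pairwise (\<lambda>i j. disjnt (cball (fst i) (snd i)) (cball (fst j) (snd j))) F \<Longrightarrow>
      \<forall>\<^sub>F z in shrinking_windows t. (1 - \<eta>) ^ d / (1 + \<eta>) * (\<Sum>i\<in>F. \<omega> * snd i ^ d / grad_norm (fst i)) \<le> slab_rate z"
proof -
  obtain \<delta> where \<delta>: "\<delta> > 0"
    "\<And>p r. p \<in> fibre \<Longrightarrow> 0 < r \<Longrightarrow> r < \<delta> \<Longrightarrow> \<forall>\<^sub>F (a, b) in shrinking_windows t.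
      \<omega> * ((1 - \<eta>) * r) ^ d * ((b - a) / ((1 + \<eta>) * grad_norm p)) \<le> measure lborel (cball p r \<inter> slab a b)"
    using slab_lower[OF \<eta>] by blast
  show thesis
  proof (rule that[OF \<delta>(1)])
    fix F assume F: "finite F" "F \<subseteq> fibre \<times> {0<..<\<delta>}"
      "pairwise (\<lambda>i j. disjnt (cball (fst i) (snd i)) (cball (fst j) (snd j))) F"
    have "\<forall>\<^sub>F z in shrinking_windows t. \<forall>i\<in>F.
      \<omega> * ((1 - \<eta>) * snd i) ^ d * ((snd z - fst z) / ((1 + \<eta>) * grad_norm (fst i))) \<le> measure lborel (cball (fst i) (snd i) \<inter> slab (fst z) (snd z))"
    proof (intro eventually_ball_finite F(1) ballI)
      fix i assume "i \<in> F"
      then have "fst i \<in> fibre" "0 < snd i" "snd i < \<delta>" using F(2) by auto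
      from \<delta>(2)[OF this]
      show "\<forall>\<^sub>F z in shrinking_windows t. \<omega> * ((1 - \<eta>) * snd i) ^ d * ((snd z - fst z) / ((1 + \<eta>) * grad_norm (fst i)))
        \<le> measure lborel (cball (fst i) (snd i) \<inter> slab (fst z) (snd z))"
        by (rule eventually_mono) (simp add: case_prod_beta)
    qed
    with eventually_window_less
    show "\<forall>\<^sub>F z in shrinking_windows t. (1 - \<eta>) ^ d / (1 + \<eta>) * (\<Sum>i\<in>F. \<omega> * snd i ^ d / grad_norm (fst i)) \<le> slab_rate z"
    proof eventually_elim
      case (elim z)
      obtain a b where z: "z = (a, b)" by (cases z)
      have fm: "cball (fst i) (snd i) \<inter> slab a b \<in> fmeasurable lborel" for i
        by (rule fmeasurableI2[OF fmeasurable_slab[of a b]]) auto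
      have "(b - a) * ((1 - \<eta>) ^ d / (1 + \<eta>) * (\<Sum>i\<in>F. \<omega> * snd i ^ d / grad_norm (fst i)))
        = (\<Sum>i\<in>F. \<omega> * ((1 - \<eta>) * snd i) ^ d * ((b - a) / ((1 + \<eta>) * grad_norm (fst i))))"
        by (simp add: sum_distrib_left power_mult_distrib mult_ac)
      also have "\<dots> \<le> (\<Sum>i\<in>F. measure lborel (cball (fst i) (snd i) \<inter> slab a b))"
        using elim(2) by (intro sum_mono) (auto simp: z)
      also have "\<dots> = measure lborel (\<Union>i\<in>F. cball (fst i) (snd i) \<inter> slab a b)"
      proof (rule measure_UNION'[symmetric, OF F(1) fm])
        show "pairwise (\<lambda>i j. disjnt (cball (fst i) (snd i) \<inter> slab a b) (cball (fst j) (snd j) \<inter> slab a b)) F"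
          using F(3) unfolding pairwise_def disjnt_def by blast
      qed
      also have "\<dots> \<le> measure lborel (slab a b)"
        by (intro measure_mono_fmeasurable fmeasurable_slab sets.finite_UN F(1) fmeasurableD[OF fm]) auto
      finally show ?case using elim(1) by (simp add: z slab_rate_def pos_le_divide_eq mult.commute)
    qed
  qed
qed

end

subsection \<open>Comparison with Hausdorff measure\<close>

text \<open>Covers in the definition are sequences, so a finite cover is padded with empty sets.
  They weigh \<open>0\<close> in every dimension by convention.\<close>

lemma hausdorff_content_le_finite:
  fixes A :: "'a::metric_space set"
  assumes I: "finite I" and A: "A \<subseteq> (\<Union>i\<in>I. C i)" and \<delta>: "\<delta> \<ge> 0"
    and C: "\<And>i. i \<in> I \<Longrightarrow> bounded (C i) \<and> diameter (C i) \<le> \<delta>"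
  shows "hausdorff_content k \<delta> A \<le> (\<Sum>i\<in>I. hausdorff_weight k (C i))"
proof -
  obtain e where e: "bij_betw e {..<card I} I"
    using ex_bij_betw_nat_finite[OF I] by (auto simp: atLeast0LessThan)
  define C' where "C' j = (if j < card I then C (e j) else {})" for j
  have eI: "e j \<in> I" if "j < card I" for j using e that by (auto simp: bij_betw_def)
  have "A \<subseteq> (\<Union>j. C' j)"
  proof
    fix x assume "x \<in> A"
    then obtain i where i: "i \<in> I" "x \<in> C i" using A by blast
    then obtain j where "j < card I" "e j = i"
      using e unfolding bij_betw_def by (metis imageE lessThan_iff)
    then show "x \<in> (\<Union>j. C' j)" using i by (auto simp: C'_def intro!: exI[of _ j])
  qed
  then have "hausdorff_content k \<delta> A \<le> (\<Sum>j. hausdorff_weight k (C' j))"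
    unfolding hausdorff_content_def using C eI \<delta>
    by (intro INF_lower) (auto simp: C'_def)
  also have "\<dots> = (\<Sum>j<card I. hausdorff_weight k (C' j))"
    by (rule suminf_finite) (auto simp: C'_def hausdorff_weight_def)
  also have "\<dots> = (\<Sum>j<card I. hausdorff_weight k (C (e j)))"
    by (intro sum.cong) (auto simp: C'_def)
  also have "\<dots> = (\<Sum>i\<in>I. hausdorff_weight k (C i))"
    by (rule sum.reindex_bij_betw[OF e])
  finally show ?thesis .
qed

text \<open>Extracting a finite subcover requires open sets, whereas Hausdorff covers are arbitrary.
  A neighbourhood of radius \<open>\<rho> / 2\<close> enlarges the diameter by at most \<rho>, and
  the weight is continuous in the diameter.\<close>

lemma open_enlargement:
  fixes C :: "'a::euclidean_space set" and c :: real
  assumes C: "bounded C" "C \<noteq> {}" and e: "e > 0" and \<sigma>: "\<sigma> > 0" and c: "c \<ge> 0"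
  shows "\<exists>U. open U \<and> C \<subseteq> U \<and> bounded U \<and> diameter U \<le> diameter C + \<sigma> \<and>
    c * (diameter U / 2) ^ k \<le> c * (diameter C / 2) ^ k + e"
proof -
  let ?h = "\<lambda>\<rho>. c * ((diameter C + \<rho>) / 2) ^ k"
  have "(?h \<longlongrightarrow> c * ((diameter C + 0) / 2) ^ k) (at_right 0)" by (intro tendsto_intros) auto
  then have "\<forall>\<^sub>F \<rho> in at_right 0. ?h \<rho> < c * ((diameter C + 0) / 2) ^ k + e"
    using e by (intro order_tendstoD(2)) auto
  moreover have "\<forall>\<^sub>F \<rho> in at_right 0. \<rho> < \<sigma>" using \<sigma> by (rule eventually_at_rightI[of 0 \<sigma>, rotated]) auto
  ultimately have "\<forall>\<^sub>F \<rho> in at_right 0. ?h \<rho> < c * (diameter C / 2) ^ k + e \<and> \<rho> < \<sigma> \<and> 0 < \<rho>"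
    using eventually_at_right_less[of "0::real"] by eventually_elim auto
  then obtain \<rho> where \<rho>: "?h \<rho> < c * (diameter C / 2) ^ k + e" "\<rho> < \<sigma>" "0 < \<rho>"
    using eventually_happens'[OF trivial_limit_at_right_real] by blast
  define U where "U = (\<Union>x\<in>C. ball x (\<rho> / 2))"
  have CU: "C \<subseteq> U" using \<rho> by (auto simp: U_def)
  have dist: "dist u v \<le> diameter C + \<rho>" if uv: "u \<in> U" "v \<in> U" for u v
  proof -
    obtain x y where "x \<in> C" "u \<in> ball x (\<rho> / 2)" "y \<in> C" "v \<in> ball y (\<rho> / 2)"
      using uv unfolding U_def by blast
    then have xy: "x \<in> C" "dist x u < \<rho> / 2" "y \<in> C" "dist y v < \<rho> / 2" by auto
    have "dist u v \<le> dist x u + dist x y + dist y v"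
      using dist_triangle[of u v x] dist_triangle[of x v y] by (simp add: dist_commute)
    then show ?thesis using diameter_bounded_bound[OF C(1) xy(1,3)] xy by linarith
  qed
  have b: "bounded U" unfolding bounded_two_points using dist by blast
  have dU: "diameter U \<le> diameter C + \<rho>"
    using CU C dist by (intro diameter_le) (auto simp: dist_norm)
  have "c * (diameter U / 2) ^ k \<le> ?h \<rho>"
    using dU c diameter_ge_0[OF b] by (intro mult_left_mono power_mono divide_right_mono) auto
  then show ?thesis using b CU dU \<rho> by (intro exI[of _ U]) (auto simp: U_def)
qed

section \<open>Existence of the limiting volume rate\<close>

context regular_level
begin

text \<open>The upper limit of \<open>slab_rate\<close>, available before the limit is known to
  exist; it turns out to be the derivative of the sublevel volume.\<close>

definition "volume_rate = Inf {u. \<forall>\<^sub>F z in shrinking_windows t. slab_rate z \<le> u}"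

lemma eventually_slab_rate_nonneg: "\<forall>\<^sub>F z in shrinking_windows t. 0 \<le> slab_rate z"
  using eventually_window_less by eventually_elim (auto simp: slab_rate_def)

lemma eventually_bounds_le:
  assumes "\<forall>\<^sub>F z in shrinking_windows t. c \<le> slab_rate z" "\<forall>\<^sub>F z in shrinking_windows t. slab_rate z \<le> u"
  shows "c \<le> u"
proof -
  from assms have "\<forall>\<^sub>F z in shrinking_windows t. c \<le> u" by eventually_elim auto
  then show ?thesis using eventually_happens'[OF shrinking_windows_neq_bot] by blast
qed

lemma slab_rate_bounded: "\<exists>u. \<forall>\<^sub>F z in shrinking_windows t. slab_rate z \<le> u"
proof -
  obtain \<delta> where \<delta>: "\<delta> > 0"
    "\<And>I C p. finite I \<Longrightarrow> (\<And>i :: real ^ 'n. i \<in> I \<Longrightarrow> open (C i) \<and> bounded (C i) \<and> diameter (C i) \<le> \<delta> \<and> p i \<in> fibre \<inter> C i) \<Longrightarrow>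
      fibre \<subseteq> (\<Union>i\<in>I. C i) \<Longrightarrow>
      \<forall>\<^sub>F z in shrinking_windows t. slab_rate z \<le> (\<Sum>i\<in>I. \<omega> * (diameter (C i) / 2) ^ d / grad_norm (p i)) / (1 - 1 / 2)"
    by (rule slab_rate_upper[of "1 / 2"]) auto
  obtain I where I: "I \<subseteq> fibre" "finite I" "fibre \<subseteq> (\<Union>x\<in>I. ball x (\<delta> / 2))"
    by (rule compactE_image[OF compact_fibre, of fibre "\<lambda>x. ball x (\<delta> / 2)"]) (use \<delta>(1) in auto)
  have "open (ball i (\<delta> / 2)) \<and> bounded (ball i (\<delta> / 2)) \<and> diameter (ball i (\<delta> / 2)) \<le> \<delta> \<and> id i \<in> fibre \<inter> ball i (\<delta> / 2)"
    if "i \<in> I" for i using that I(1) \<delta>(1) by auto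
  from \<delta>(2)[OF I(2) this I(3)] show ?thesis by blast
qed

lemma volume_rate_le: "\<forall>\<^sub>F z in shrinking_windows t. slab_rate z \<le> u \<Longrightarrow> volume_rate \<le> u"
  unfolding volume_rate_def using eventually_bounds_le[OF eventually_slab_rate_nonneg]
  by (intro cInf_lower bdd_belowI[of _ 0]) auto

lemma le_volume_rate: "\<forall>\<^sub>F z in shrinking_windows t. c \<le> slab_rate z \<Longrightarrow> c \<le> volume_rate"
  unfolding volume_rate_def using slab_rate_bounded eventually_bounds_le by (intro cInf_greatest) auto

lemma volume_rate_nonneg: "0 \<le> volume_rate"
  by (rule le_volume_rate[OF eventually_slab_rate_nonneg])

text \<open>One Vitali family bounds the rate from both sides by the same sum \<open>X\<close>, up
  to factors tending to \<open>1\<close> and a small tail term. So \<open>X\<close> never has to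
  converge itself. The scale \<open>\<delta>0\<close> is free, for use in Hausdorff
  contents.\<close>

lemma approximate_cover:
  assumes \<eta>: "0 < \<eta>" "\<eta> < 1" and \<tau>: "\<tau> > 0" and \<delta>0: "\<delta>0 > 0"
  obtains F G X where "finite F" "finite G" "F \<subseteq> fibre \<times> {0<..<\<delta>0}" "G \<subseteq> fibre \<times> {0<..<\<delta>0}"
    "fibre \<subseteq> (\<Union>i\<in>F. ball (fst i) ((1 + \<eta>) * snd i)) \<union> (\<Union>i\<in>G. ball (fst i) (5 * snd i))"
    "(\<Sum>i\<in>G. \<omega> * (5 * snd i) ^ d) \<le> \<tau>"
    "X = (\<Sum>i\<in>F. \<omega> * snd i ^ d / grad_norm (fst i))"
    "\<forall>\<^sub>F z in shrinking_windows t. (1 - \<eta>) ^ d / (1 + \<eta>) * X \<le> slab_rate z"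
    "\<forall>\<^sub>F z in shrinking_windows t. slab_rate z \<le> ((1 + \<eta>) ^ d * X + \<tau> / grad_min) / (1 - \<eta>)"
proof -
  obtain \<delta>1 where \<delta>1: "\<delta>1 > 0"
    "\<And>I C p. finite I \<Longrightarrow> (\<And>i :: (real ^ 'n) \<times> real + (real ^ 'n) \<times> real. i \<in> I \<Longrightarrow>
        open (C i) \<and> bounded (C i) \<and> diameter (C i) \<le> \<delta>1 \<and> p i \<in> fibre \<inter> C i) \<Longrightarrow>
      fibre \<subseteq> (\<Union>i\<in>I. C i) \<Longrightarrow>
      \<forall>\<^sub>F z in shrinking_windows t. slab_rate z \<le> (\<Sum>i\<in>I. \<omega> * (diameter (C i) / 2) ^ d / grad_norm (p i)) / (1 - \<eta>)"
    using slab_rate_upper[OF \<eta>] by blast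
  obtain \<delta>2 where \<delta>2: "\<delta>2 > 0"
    "\<And>F. finite F \<Longrightarrow> F \<subseteq> fibre \<times> {0<..<\<delta>2} \<Longrightarrow>
      pairwise (\<lambda>i j. disjnt (cball (fst i) (snd i)) (cball (fst j) (snd j))) F \<Longrightarrow>
      \<forall>\<^sub>F z in shrinking_windows t. (1 - \<eta>) ^ d / (1 + \<eta>) * (\<Sum>i\<in>F. \<omega> * snd i ^ d / grad_norm (fst i)) \<le> slab_rate z"
    using slab_rate_lower[OF \<eta>] by blast
  \<comment> \<open>A fivefold enlarged ball has ten times the radius as its diameter, hence the
    division by \<open>10\<close>.\<close>
  define \<delta> where "\<delta> = min \<delta>0 (min \<delta>2 (\<delta>1 / 10))"
  have \<delta>: "\<delta> > 0" "\<delta> \<le> \<delta>0" "\<delta> \<le> \<delta>2" "10 * \<delta> \<le> \<delta>1"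
    using \<delta>0 \<delta>1(1) \<delta>2(1) by (auto simp: \<delta>_def)
  \<comment> \<open>Each ball of a disjoint family contributes at least \<open>c * snd i ^ d\<close>
    to the rate. Since \<open>volume_rate\<close> caps the total, this yields the uniform bound that
    \<open>finite_Vitali_cover\<close> requires.\<close>
  define c where "c = (1 - \<eta>) ^ d / (1 + \<eta>) * \<omega> / grad_max"
  have grad_max: "grad_max > 0" using grad_max_attained grad_norm_pos by metis
  have c: "c > 0" using \<eta> grad_max by (simp add: c_def)
  have bound: "(\<Sum>i\<in>F. snd i ^ d) \<le> volume_rate / c" if F: "finite F" "F \<subseteq> fibre \<times> {0<..<\<delta>}"
    "pairwise (\<lambda>i j. disjnt (cball (fst i) (snd i)) (cball (fst j) (snd j))) F" for F
  proof -
    have "F \<subseteq> fibre \<times> {0<..<\<delta>2}" using F(2) \<delta>(3) by fastforce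
    then have "(1 - \<eta>) ^ d / (1 + \<eta>) * (\<Sum>i\<in>F. \<omega> * snd i ^ d / grad_norm (fst i)) \<le> volume_rate"
      by (intro le_volume_rate \<delta>2(2) F)
    moreover have "c * (\<Sum>i\<in>F. snd i ^ d) \<le> (1 - \<eta>) ^ d / (1 + \<eta>) * (\<Sum>i\<in>F. \<omega> * snd i ^ d / grad_norm (fst i))"
    proof -
      have "\<omega> * snd i ^ d / grad_max \<le> \<omega> * snd i ^ d / grad_norm (fst i)" if "i \<in> F" for i
      proof -
        have "fst i \<in> fibre" "0 < snd i" using that F(2) by auto
        then show ?thesis using le_grad_max[of "fst i"] grad_norm_pos[of "fst i"] grad_max by (intro divide_left_mono) auto
      qed
      then have "(\<Sum>i\<in>F. \<omega> * snd i ^ d / grad_max) \<le> (\<Sum>i\<in>F. \<omega> * snd i ^ d / grad_norm (fst i))" by (intro sum_mono)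
      then have "(1 - \<eta>) ^ d / (1 + \<eta>) * (\<Sum>i\<in>F. \<omega> * snd i ^ d / grad_max) \<le> (1 - \<eta>) ^ d / (1 + \<eta>) * (\<Sum>i\<in>F. \<omega> * snd i ^ d / grad_norm (fst i))"
        using \<eta> by (intro mult_left_mono) auto
      moreover have "c * (\<Sum>i\<in>F. snd i ^ d) = (1 - \<eta>) ^ d / (1 + \<eta>) * (\<Sum>i\<in>F. \<omega> * snd i ^ d / grad_max)"
        unfolding c_def sum_distrib_left by (intro sum.cong) auto
      ultimately show ?thesis by simp
    qed
    ultimately show ?thesis using c by (simp add: pos_le_divide_eq mult.commute)
  qed
  have \<tau>': "\<tau> / (\<omega> * 5 ^ d) > 0" using \<tau> by simp
  obtain F G where FG: "finite F" "F \<subseteq> fibre \<times> {0<..<\<delta>}" "finite G" "G \<subseteq> fibre \<times> {0<..<\<delta>}"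
    "pairwise (\<lambda>i j. disjnt (cball (fst i) (snd i)) (cball (fst j) (snd j))) F"
    "fibre \<subseteq> (\<Union>i\<in>F. ball (fst i) ((1 + \<eta>) * snd i)) \<union> (\<Union>i\<in>G. ball (fst i) (5 * snd i))"
    "(\<Sum>i\<in>G. snd i ^ d) \<le> \<tau> / (\<omega> * 5 ^ d)"
    by (rule finite_Vitali_cover[OF compact_fibre \<delta>(1) \<eta>(1) \<tau>' bound])
  define X where "X = (\<Sum>i\<in>F. \<omega> * snd i ^ d / grad_norm (fst i))"
  have G\<tau>: "(\<Sum>i\<in>G. \<omega> * (5 * snd i) ^ d) \<le> \<tau>"
  proof -
    have "(\<Sum>i\<in>G. \<omega> * (5 * snd i) ^ d) = (\<omega> * 5 ^ d) * (\<Sum>i\<in>G. snd i ^ d)"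
      by (simp add: sum_distrib_left power_mult_distrib mult_ac)
    also have "\<dots> \<le> (\<omega> * 5 ^ d) * (\<tau> / (\<omega> * 5 ^ d))" using FG(7) by (intro mult_left_mono) auto
    also have "\<dots> = \<tau>" using omega_pos by (simp del: unit_ball_vol_pos)
    finally show ?thesis .
  qed
  have sub: "\<And>A. A \<subseteq> fibre \<times> {0<..<\<delta>} \<Longrightarrow> A \<subseteq> fibre \<times> {0<..<\<delta>0}" "\<And>A. A \<subseteq> fibre \<times> {0<..<\<delta>} \<Longrightarrow> A \<subseteq> fibre \<times> {0<..<\<delta>2}"
    using \<delta>(2,3) by fastforce+
  \<comment> \<open>Indexing by a disjoint sum keeps the two enlargement factors apart.\<close>
  define C where "C = case_sum (\<lambda>i. ball (fst i) ((1 + \<eta>) * snd i)) (\<lambda>i. ball (fst i :: real ^ 'n) (5 * snd i))"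
  define p where "p = case_sum (fst :: (real ^ 'n) \<times> real \<Rightarrow> _) (fst :: (real ^ 'n) \<times> real \<Rightarrow> _)"
  have C: "open (C i) \<and> bounded (C i) \<and> diameter (C i) \<le> \<delta>1 \<and> p i \<in> fibre \<inter> C i" if "i \<in> F <+> G" for i
  proof -
    from that consider j where "j \<in> F" "i = Inl j" | j where "j \<in> G" "i = Inr j" by blast
    then show ?thesis
    proof cases
      case 1
      then have j: "fst j \<in> fibre" "0 < snd j" "snd j < \<delta>" using FG(2) by auto
      have "(1 + \<eta>) * snd j \<le> 2 * snd j" using j \<eta> by (intro mult_right_mono) auto
      then have "2 * ((1 + \<eta>) * snd j) \<le> \<delta>1" using j(3) \<delta>(1,4) by linarith
      moreover have "0 < (1 + \<eta>) * snd j" using j \<eta> by simp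
      ultimately show ?thesis using 1 j by (simp add: C_def p_def)
    next
      case 2
      then have j: "fst j \<in> fibre" "0 < snd j" "snd j < \<delta>" using FG(4) by auto
      then show ?thesis using 2 \<delta>(1,4) by (simp add: C_def p_def)
    qed
  qed
  have "finite (F <+> G)" using FG by simp
  moreover have "fibre \<subseteq> (\<Union>i\<in>F <+> G. C i)"
  proof
    fix x assume "x \<in> fibre"
    then consider i where "i \<in> F" "x \<in> C (Inl i)" | i where "i \<in> G" "x \<in> C (Inr i)"
      using FG(6) by (auto simp: C_def)
    then show "x \<in> (\<Union>i\<in>F <+> G. C i)" by cases blast+
  qed
  ultimately have up: "\<forall>\<^sub>F z in shrinking_windows t. slab_rate z \<le> (\<Sum>i\<in>F <+> G. \<omega> * (diameter (C i) / 2) ^ d / grad_norm (p i)) / (1 - \<eta>)"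
    using C by (intro \<delta>1(2)) auto
  have "(\<Sum>i\<in>F <+> G. \<omega> * (diameter (C i) / 2) ^ d / grad_norm (p i)) =
    (\<Sum>i\<in>F. \<omega> * ((1 + \<eta>) * snd i) ^ d / grad_norm (fst i)) + (\<Sum>i\<in>G. \<omega> * (5 * snd i) ^ d / grad_norm (fst i))"
  proof -
    have "diameter (C (Inl i)) / 2 = (1 + \<eta>) * snd i" if "i \<in> F" for i
    proof -
      have "0 < snd i" using that FG(2) by auto
      then have "0 < (1 + \<eta>) * snd i" using \<eta> by simp
      then show ?thesis by (simp add: C_def)
    qed
    moreover have "diameter (C (Inr i)) / 2 = 5 * snd i" if "i \<in> G" for i
    proof -
      have "0 < snd i" using that FG(4) by auto
      then show ?thesis by (simp add: C_def)
    qed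
    ultimately show ?thesis using FG(1,3)
      by (subst sum.Plus) (auto simp: p_def intro!: arg_cong2[of _ _ _ _ "(+)"] sum.cong)
  qed
  also have "\<dots> \<le> (1 + \<eta>) ^ d * X + \<tau> / grad_min"
  proof (rule add_mono)
    show "(\<Sum>i\<in>F. \<omega> * ((1 + \<eta>) * snd i) ^ d / grad_norm (fst i)) \<le> (1 + \<eta>) ^ d * X"
      by (simp add: X_def sum_distrib_left power_mult_distrib mult_ac)
    have "(\<Sum>i\<in>G. \<omega> * (5 * snd i) ^ d / grad_norm (fst i)) \<le> (\<Sum>i\<in>G. \<omega> * (5 * snd i) ^ d / grad_min)"
    proof (intro sum_mono)
      fix i assume "i \<in> G"
      then have "fst i \<in> fibre" "0 < snd i" using FG(4) by auto
      then show "\<omega> * (5 * snd i) ^ d / grad_norm (fst i) \<le> \<omega> * (5 * snd i) ^ d / grad_min"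
        using grad_min_le[of "fst i"] grad_norm_pos[of "fst i"] grad_min_pos by (intro divide_left_mono) auto
    qed
    also have "\<dots> \<le> \<tau> / grad_min"
      using G\<tau> grad_min_pos by (simp add: sum_divide_distrib[symmetric] divide_right_mono)
    finally show "(\<Sum>i\<in>G. \<omega> * (5 * snd i) ^ d / grad_norm (fst i)) \<le> \<tau> / grad_min" .
  qed
  finally have "(\<Sum>i\<in>F <+> G. \<omega> * (diameter (C i) / 2) ^ d / grad_norm (p i)) / (1 - \<eta>) \<le> ((1 + \<eta>) ^ d * X + \<tau> / grad_min) / (1 - \<eta>)"
    using \<eta> by (intro divide_right_mono) auto
  then have up': "\<forall>\<^sub>F z in shrinking_windows t. slab_rate z \<le> ((1 + \<eta>) ^ d * X + \<tau> / grad_min) / (1 - \<eta>)"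
    using up by (auto elim: eventually_mono)
  have lo: "\<forall>\<^sub>F z in shrinking_windows t. (1 - \<eta>) ^ d / (1 + \<eta>) * X \<le> slab_rate z"
    unfolding X_def using FG sub by (intro \<delta>2(2)) auto
  show thesis
    by (rule that[OF FG(1,3) sub(1)[OF FG(2)] sub(1)[OF FG(4)] FG(6) G\<tau> X_def lo up'])
qed

text \<open>The upper half is the definition of \<open>volume_rate\<close> as an upper limit. For
  the lower half, the upper estimate of \<open>approximate_cover\<close> forces \<open>X\<close> to
  be large, and then the lower estimate forces the rate to be large.\<close>

lemma slab_rate_tendsto: "(slab_rate \<longlongrightarrow> volume_rate) (shrinking_windows t)"
proof (rule order_tendstoI)
  fix a assume "volume_rate < a"
  then obtain u where u: "volume_rate < u" "u < a" using dense by blast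
  then obtain u' where "\<forall>\<^sub>F z in shrinking_windows t. slab_rate z \<le> u'" "u' < u"
    using cInf_lessD[of "{u. \<forall>\<^sub>F z in shrinking_windows t. slab_rate z \<le> u}" u] slab_rate_bounded by (auto simp: volume_rate_def)
  then show "\<forall>\<^sub>F z in shrinking_windows t. slab_rate z < a" using u by (auto elim: eventually_mono)
next
  fix a assume a: "a < volume_rate"
  \<comment> \<open>Solve the upper estimate with \<open>\<tau> = \<eta>\<close> for
    \<open>X\<close> and insert the result into the lower estimate; this tends to
    \<open>volume_rate\<close> as \<eta> decreases to \<open>0\<close>.\<close>
  define E where "E \<eta> = (1 - \<eta>) ^ d / (1 + \<eta>) * (((1 - \<eta>) * volume_rate - \<eta> / grad_min) / (1 + \<eta>) ^ d)" for \<eta> :: real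
  have "(E \<longlongrightarrow> (1 - 0) ^ d / (1 + 0) * (((1 - 0) * volume_rate - 0 / grad_min) / (1 + 0) ^ d)) (at_right 0)"
    unfolding E_def using grad_min_pos by (intro tendsto_intros) auto
  then have "\<forall>\<^sub>F \<eta> in at_right 0. a < E \<eta>" using a by (intro order_tendstoD(1)) auto
  moreover have "\<forall>\<^sub>F \<eta> in at_right (0::real). \<eta> < 1" by (rule eventually_at_rightI[of 0 1]) auto
  ultimately have "\<forall>\<^sub>F \<eta> in at_right 0. a < E \<eta> \<and> \<eta> < 1 \<and> 0 < \<eta>"
    using eventually_at_right_less[of "0::real"] by eventually_elim auto
  then obtain \<eta> where \<eta>: "a < E \<eta>" "0 < \<eta>" "\<eta> < 1"
    using eventually_happens'[OF trivial_limit_at_right_real] by blast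
  obtain F G X where X: "\<forall>\<^sub>F z in shrinking_windows t. (1 - \<eta>) ^ d / (1 + \<eta>) * X \<le> slab_rate z"
    "\<forall>\<^sub>F z in shrinking_windows t. slab_rate z \<le> ((1 + \<eta>) ^ d * X + \<eta> / grad_min) / (1 - \<eta>)"
    by (rule approximate_cover[OF \<eta>(2,3,2) zero_less_one])
  have "volume_rate \<le> ((1 + \<eta>) ^ d * X + \<eta> / grad_min) / (1 - \<eta>)" by (rule volume_rate_le[OF X(2)])
  then have "((1 - \<eta>) * volume_rate - \<eta> / grad_min) / (1 + \<eta>) ^ d \<le> X"
    using \<eta> by (simp add: pos_le_divide_eq pos_divide_le_eq mult.commute)
  then have "E \<eta> \<le> (1 - \<eta>) ^ d / (1 + \<eta>) * X"
    unfolding E_def using \<eta> by (intro mult_left_mono) auto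
  then show "\<forall>\<^sub>F z in shrinking_windows t. a < slab_rate z"
    using X(1) \<eta>(1) by (auto elim: eventually_mono)
qed

section \<open>Area of the fibre against the volume rate\<close>

text \<open>The Vitali cover competes in the Hausdorff content. Each term of \<open>X\<close> is the
  weight of a ball divided by the gradient norm at its centre, so the total weight is at most
  \<open>grad_max * X\<close> up to enlargement.\<close>

lemma hausdorff_measure_le: "hausdorff_measure d fibre \<le> ennreal (grad_max * volume_rate)"
  unfolding hausdorff_measure_def
proof (rule SUP_least)
  fix \<delta> :: real assume "\<delta> \<in> {0<..}"
  then have \<delta>: "\<delta> > 0" "\<delta> / 10 > 0" by auto
  have grad_max: "grad_max > 0" using grad_max_attained grad_norm_pos by metis
  \<comment> \<open>The factor \<open>(1 + \<eta>) ^ d\<close> pays for the enlarged balls of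
    \<open>F\<close>, the bracket bounds \<open>X\<close>, and the final \<eta> pays for the balls
    of \<open>G\<close>.\<close>
  define E where "E \<eta> = (1 + \<eta>) ^ d * grad_max * (volume_rate * (1 + \<eta>) / (1 - \<eta>) ^ d) + \<eta>" for \<eta> :: real
  have "hausdorff_content d \<delta> fibre \<le> ennreal (E \<eta>)" if \<eta>: "0 < \<eta>" "\<eta> < 1" for \<eta>
  proof -
    obtain F G X where FG: "finite F" "finite G" "F \<subseteq> fibre \<times> {0<..<\<delta> / 10}" "G \<subseteq> fibre \<times> {0<..<\<delta> / 10}"
      "fibre \<subseteq> (\<Union>i\<in>F. ball (fst i) ((1 + \<eta>) * snd i)) \<union> (\<Union>i\<in>G. ball (fst i) (5 * snd i))"
      "(\<Sum>i\<in>G. \<omega> * (5 * snd i) ^ d) \<le> \<eta>"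
      "X = (\<Sum>i\<in>F. \<omega> * snd i ^ d / grad_norm (fst i))"
      "\<forall>\<^sub>F z in shrinking_windows t. (1 - \<eta>) ^ d / (1 + \<eta>) * X \<le> slab_rate z"
      by (rule approximate_cover[OF \<eta> \<eta>(1) \<delta>(2)])
    have "(1 - \<eta>) ^ d / (1 + \<eta>) * X \<le> volume_rate" by (rule le_volume_rate[OF FG(8)])
    then have XD: "X \<le> volume_rate * (1 + \<eta>) / (1 - \<eta>) ^ d"
      using \<eta> by (simp add: pos_le_divide_eq pos_divide_le_eq mult.commute)
    define C where "C = case_sum (\<lambda>i. ball (fst i) ((1 + \<eta>) * snd i)) (\<lambda>i. ball (fst i :: real ^ 'n) (5 * snd i))"
    have CF: "bounded (C (Inl i)) \<and> diameter (C (Inl i)) \<le> \<delta>"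
      "hausdorff_weight d (C (Inl i)) \<le> ennreal ((1 + \<eta>) ^ d * grad_max * (\<omega> * snd i ^ d / grad_norm (fst i)))" if "i \<in> F" for i
    proof -
      have i: "fst i \<in> fibre" "0 < snd i" "snd i < \<delta> / 10" using that FG(3) by auto
      have pos: "0 < (1 + \<eta>) * snd i" using i \<eta> by simp
      have "(1 + \<eta>) * snd i \<le> 2 * snd i" using i \<eta> by (intro mult_right_mono) auto
      then have "2 * ((1 + \<eta>) * snd i) \<le> \<delta>" using i(3) \<delta>(1) by linarith
      then show "bounded (C (Inl i)) \<and> diameter (C (Inl i)) \<le> \<delta>" using pos by (simp add: C_def)
      have "C (Inl i) \<noteq> {}" "diameter (C (Inl i)) / 2 = (1 + \<eta>) * snd i" using pos by (auto simp: C_def)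
      then have "hausdorff_weight d (C (Inl i)) = ennreal (\<omega> * ((1 + \<eta>) * snd i) ^ d)"
        by (simp add: hausdorff_weight_def)
      also have "\<dots> \<le> ennreal ((1 + \<eta>) ^ d * grad_max * (\<omega> * snd i ^ d / grad_norm (fst i)))"
      proof (rule ennreal_leI)
        have "\<omega> * ((1 + \<eta>) * snd i) ^ d = (1 + \<eta>) ^ d * grad_norm (fst i) * (\<omega> * snd i ^ d / grad_norm (fst i))"
          using grad_norm_pos[OF i(1)] by (simp add: power_mult_distrib)
        also have "\<dots> \<le> (1 + \<eta>) ^ d * grad_max * (\<omega> * snd i ^ d / grad_norm (fst i))"
          using le_grad_max[OF i(1)] grad_norm_pos[OF i(1)] i \<eta> by (intro mult_right_mono mult_left_mono) auto
        finally show "\<omega> * ((1 + \<eta>) * snd i) ^ d \<le> \<dots>" .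
      qed
      finally show "hausdorff_weight d (C (Inl i)) \<le> \<dots>" .
    qed
    have CG: "bounded (C (Inr i)) \<and> diameter (C (Inr i)) \<le> \<delta>"
      "hausdorff_weight d (C (Inr i)) = ennreal (\<omega> * (5 * snd i) ^ d)" if "i \<in> G" for i
    proof -
      have i: "0 < snd i" "snd i < \<delta> / 10" using that FG(4) by auto
      then show "bounded (C (Inr i)) \<and> diameter (C (Inr i)) \<le> \<delta>" by (simp add: C_def)
      have "C (Inr i) \<noteq> {}" "diameter (C (Inr i)) / 2 = 5 * snd i" using i by (auto simp: C_def)
      then show "hausdorff_weight d (C (Inr i)) = ennreal (\<omega> * (5 * snd i) ^ d)"
        by (simp add: hausdorff_weight_def)
    qed
    have cov: "fibre \<subseteq> (\<Union>i\<in>F <+> G. C i)"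
    proof
      fix x assume "x \<in> fibre"
      then consider i where "i \<in> F" "x \<in> C (Inl i)" | i where "i \<in> G" "x \<in> C (Inr i)"
        using FG(5) by (auto simp: C_def)
      then show "x \<in> (\<Union>i\<in>F <+> G. C i)" by cases blast+
    qed
    have "hausdorff_content d \<delta> fibre \<le> (\<Sum>i\<in>F <+> G. hausdorff_weight d (C i))"
      by (rule hausdorff_content_le_finite[OF _ cov]) (use FG(1,2) CF(1) CG(1) \<delta>(1) in auto)
    also have "\<dots> = (\<Sum>i\<in>F. hausdorff_weight d (C (Inl i))) + (\<Sum>i\<in>G. hausdorff_weight d (C (Inr i)))"
      using FG(1,2) by (subst sum.Plus) auto
    also have "\<dots> \<le> (\<Sum>i\<in>F. ennreal ((1 + \<eta>) ^ d * grad_max * (\<omega> * snd i ^ d / grad_norm (fst i)))) + (\<Sum>i\<in>G. ennreal (\<omega> * (5 * snd i) ^ d))"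
      using CF(2) CG(2) by (intro add_mono sum_mono) auto
    also have "\<dots> = ennreal ((1 + \<eta>) ^ d * grad_max * X) + ennreal (\<Sum>i\<in>G. \<omega> * (5 * snd i) ^ d)"
    proof -
      have "0 \<le> (1 + \<eta>) ^ d * grad_max * (\<omega> * snd i ^ d / grad_norm (fst i))" if "i \<in> F" for i
        using that FG(3) \<eta> grad_max grad_norm_pos[of "fst i"] by (fastforce intro!: mult_nonneg_nonneg divide_nonneg_pos)
      moreover have "0 \<le> \<omega> * (5 * snd i) ^ d" if "i \<in> G" for i
        using that FG(4) by fastforce
      ultimately show ?thesis by (simp add: FG(7) sum_distrib_left sum_ennreal del: times_divide_eq_right)
    qed
    also have "\<dots> \<le> ennreal ((1 + \<eta>) ^ d * grad_max * (volume_rate * (1 + \<eta>) / (1 - \<eta>) ^ d)) + ennreal \<eta>"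
      using XD FG(6) \<eta> grad_max by (intro add_mono ennreal_leI mult_left_mono) auto
    also have "\<dots> = ennreal (E \<eta>)"
      unfolding E_def using \<eta> grad_max volume_rate_nonneg by (intro ennreal_plus[symmetric]) auto
    finally show ?thesis .
  qed
  then have "\<forall>\<^sub>F \<eta> in at_right 0. hausdorff_content d \<delta> fibre \<le> ennreal (E \<eta>)"
    by (intro eventually_at_rightI[of 0 1]) auto
  moreover have "((\<lambda>\<eta>. ennreal (E \<eta>)) \<longlongrightarrow> ennreal ((1 + 0) ^ d * grad_max * (volume_rate * (1 + 0) / (1 - 0) ^ d) + 0)) (at_right 0)"
    unfolding E_def by (intro tendsto_ennrealI tendsto_intros) auto
  ultimately have "hausdorff_content d \<delta> fibre \<le> ennreal ((1 + 0) ^ d * grad_max * (volume_rate * (1 + 0) / (1 - 0) ^ d) + 0)"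
    by (intro tendsto_lowerbound) auto
  then show "hausdorff_content d \<delta> fibre \<le> ennreal (grad_max * volume_rate)" by simp
qed

text \<open>Every fine cover, made open and finite, bounds the volume rate by its weights divided by
  gradient norms, hence by its total weight over \<open>grad_min\<close>. The isodiametric
  inequality enters here, through \<open>slab_rate_upper\<close>, for covering sets of any
  shape.\<close>

lemma hausdorff_measure_ge: "ennreal (grad_min * volume_rate) \<le> hausdorff_measure d fibre"
proof -
  have main: "ennreal ((1 - \<eta>) * grad_min * volume_rate) \<le> hausdorff_measure d fibre" if \<eta>: "0 < \<eta>" "\<eta> < 1" for \<eta>
  proof -
    obtain \<delta> where \<delta>: "\<delta> > 0"
      "\<And>I C p. finite I \<Longrightarrow> (\<And>i :: nat. i \<in> I \<Longrightarrow> open (C i) \<and> bounded (C i) \<and> diameter (C i) \<le> \<delta> \<and> p i \<in> fibre \<inter> C i) \<Longrightarrow>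
        fibre \<subseteq> (\<Union>i\<in>I. C i) \<Longrightarrow>
        \<forall>\<^sub>F z in shrinking_windows t. slab_rate z \<le> (\<Sum>i\<in>I. \<omega> * (diameter (C i) / 2) ^ d / grad_norm (p i)) / (1 - \<eta>)"
      using slab_rate_upper[OF \<eta>] by blast
    \<comment> \<open>Covers at scale \<open>\<delta> / 2\<close> leave another
      \<open>\<delta> / 2\<close> for the open enlargement.\<close>
    have "ennreal ((1 - \<eta>) * grad_min * volume_rate) \<le> hausdorff_content d (\<delta> / 2) fibre"
      unfolding hausdorff_content_def
    proof (rule INF_greatest, rule ennreal_le_epsilon)
      fix C :: "nat \<Rightarrow> (real ^ 'n) set" and e :: real
      assume "C \<in> {C. fibre \<subseteq> (\<Union>i. C i) \<and> (\<forall>i. bounded (C i) \<and> diameter (C i) \<le> \<delta> / 2)}" and e: "0 < e"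
      then have C: "fibre \<subseteq> (\<Union>i. C i)" "\<And>i. bounded (C i)" "\<And>i. diameter (C i) \<le> \<delta> / 2" by auto
      \<comment> \<open>The excesses \<open>e * (1 / 2) ^ Suc i\<close> sum to \<open>e\<close>. For
        nonempty members the weight is given by the diameter formula even if
        \<open>d = 0\<close>.\<close>
      have "\<exists>V. C i \<noteq> {} \<longrightarrow> open V \<and> C i \<subseteq> V \<and> bounded V \<and> diameter V \<le> diameter (C i) + \<delta> / 2 \<and>
        \<omega> * (diameter V / 2) ^ d \<le> \<omega> * (diameter (C i) / 2) ^ d + e * (1 / 2) ^ Suc i" for i
      proof (cases "C i = {}")
        case False
        have "0 < e * (1 / 2) ^ Suc i" "0 < \<delta> / 2" "0 \<le> \<omega>" using e \<delta>(1) by simp_all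
        from open_enlargement[OF C(2) False this, of d] show ?thesis by blast
      qed simp
      then have "\<exists>U. \<forall>i. C i \<noteq> {} \<longrightarrow> open (U i) \<and> C i \<subseteq> U i \<and> bounded (U i) \<and> diameter (U i) \<le> diameter (C i) + \<delta> / 2 \<and>
        \<omega> * (diameter (U i) / 2) ^ d \<le> \<omega> * (diameter (C i) / 2) ^ d + e * (1 / 2) ^ Suc i"
        by (intro choice allI)
      then obtain U where U': "\<forall>i. C i \<noteq> {} \<longrightarrow> open (U i) \<and> C i \<subseteq> U i \<and> bounded (U i) \<and> diameter (U i) \<le> diameter (C i) + \<delta> / 2 \<and>
        \<omega> * (diameter (U i) / 2) ^ d \<le> \<omega> * (diameter (C i) / 2) ^ d + e * (1 / 2) ^ Suc i" by (elim exE) (rule that)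
      note U = U'[rule_format]
      \<comment> \<open>Members that miss the fibre are dropped, because
        \<open>slab_rate_upper\<close> compares each set with the gradient at a fibre point inside
        it.\<close>
      define J where "J = {i. C i \<inter> fibre \<noteq> {}}"
      have J: "C i \<noteq> {}" if "i \<in> J" for i using that by (auto simp: J_def)
      define p where "p i = (SOME x. x \<in> C i \<inter> fibre)" for i
      have p: "p i \<in> C i \<inter> fibre" if "i \<in> J" for i
        unfolding p_def some_in_eq using that by (simp add: J_def)
      have "fibre \<subseteq> (\<Union>i\<in>J. U i)"
      proof
        fix x assume "x \<in> fibre"
        then obtain i where "x \<in> C i" "i \<in> J" using C(1) unfolding J_def by blast
        then show "x \<in> (\<Union>i\<in>J. U i)" using U[OF J] by blast
      qed
      then obtain I where I: "I \<subseteq> J" "finite I" "fibre \<subseteq> (\<Union>i\<in>I. U i)"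
        by (rule compactE_image[OF compact_fibre, of J U, rotated]) (use U[OF J] in auto)
      have "\<forall>\<^sub>F z in shrinking_windows t. slab_rate z \<le> (\<Sum>i\<in>I. \<omega> * (diameter (U i) / 2) ^ d / grad_norm (p i)) / (1 - \<eta>)"
      proof (intro \<delta>(2) I)
        fix i assume "i \<in> I"
        then have i: "i \<in> J" using I by auto
        show "open (U i) \<and> bounded (U i) \<and> diameter (U i) \<le> \<delta> \<and> p i \<in> fibre \<inter> U i"
          using U[OF J[OF i]] p[OF i] C(3)[of i] by auto
      qed
      then have "volume_rate \<le> (\<Sum>i\<in>I. \<omega> * (diameter (U i) / 2) ^ d / grad_norm (p i)) / (1 - \<eta>)" by (rule volume_rate_le)
      then have "(1 - \<eta>) * volume_rate \<le> (\<Sum>i\<in>I. \<omega> * (diameter (U i) / 2) ^ d / grad_norm (p i))"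
        using \<eta> by (simp add: pos_le_divide_eq mult.commute)
      also have "\<dots> \<le> (\<Sum>i\<in>I. (\<omega> * (diameter (C i) / 2) ^ d + e * (1 / 2) ^ Suc i) / grad_min)"
      proof (intro sum_mono frac_le)
        fix i assume "i \<in> I"
        then have i: "i \<in> J" using I by auto
        show "\<omega> * (diameter (U i) / 2) ^ d \<le> \<omega> * (diameter (C i) / 2) ^ d + e * (1 / 2) ^ Suc i"
          using U[OF J[OF i]] by blast
        show "grad_min \<le> grad_norm (p i)" using grad_min_le p[OF i] by auto
        show "0 \<le> \<omega> * (diameter (C i) / 2) ^ d + e * (1 / 2) ^ Suc i"
          using e diameter_ge_0[OF C(2)[of i]] by (intro add_nonneg_nonneg mult_nonneg_nonneg) auto
      qed (rule grad_min_pos)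
      finally have "(1 - \<eta>) * volume_rate \<le> (\<Sum>i\<in>I. \<omega> * (diameter (C i) / 2) ^ d + e * (1 / 2) ^ Suc i) / grad_min"
        by (simp add: sum_divide_distrib)
      then have "(1 - \<eta>) * grad_min * volume_rate \<le> (\<Sum>i\<in>I. \<omega> * (diameter (C i) / 2) ^ d) + (\<Sum>i\<in>I. e * (1 / 2) ^ Suc i)"
        using grad_min_pos by (simp add: pos_le_divide_eq sum.distrib mult_ac)
      also have "(\<Sum>i\<in>I. e * (1 / 2) ^ Suc i) \<le> e"
      proof -
        have "(\<lambda>i. e * (1 / 2) ^ Suc i) sums (e * 1)" by (intro sums_mult power_half_series)
        then show ?thesis
          using sum_le_suminf[of "\<lambda>i. e * (1 / 2) ^ Suc i" I] I(2) e by (simp add: sums_iff)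
      qed
      finally have "ennreal ((1 - \<eta>) * grad_min * volume_rate) \<le> ennreal ((\<Sum>i\<in>I. \<omega> * (diameter (C i) / 2) ^ d) + e)"
        by (intro ennreal_leI) simp
      also have "\<dots> = (\<Sum>i\<in>I. ennreal (\<omega> * (diameter (C i) / 2) ^ d)) + ennreal e"
        using e diameter_ge_0[OF C(2)] by (subst ennreal_plus) (auto simp: sum_ennreal intro!: sum_nonneg)
      also have "(\<Sum>i\<in>I. ennreal (\<omega> * (diameter (C i) / 2) ^ d)) = (\<Sum>i\<in>I. hausdorff_weight d (C i))"
        using J I(1) by (intro sum.cong) (auto simp: hausdorff_weight_def)
      also have "\<dots> \<le> (\<Sum>i. hausdorff_weight d (C i))"
        using I(2) by (intro sum_le_suminf) auto
      finally show "ennreal ((1 - \<eta>) * grad_min * volume_rate) \<le> (\<Sum>i. hausdorff_weight d (C i)) + ennreal e"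
        by (simp add: add_right_mono)
    qed
    also have "\<dots> \<le> hausdorff_measure d fibre"
      unfolding hausdorff_measure_def using \<delta>(1) by (intro SUP_upper) auto
    finally show ?thesis .
  qed
  then have "\<forall>\<^sub>F \<eta> in at_right 0. ennreal ((1 - \<eta>) * grad_min * volume_rate) \<le> hausdorff_measure d fibre"
    by (intro eventually_at_rightI[of 0 1]) auto
  moreover have "((\<lambda>\<eta>. ennreal ((1 - \<eta>) * grad_min * volume_rate)) \<longlongrightarrow> ennreal ((1 - 0) * grad_min * volume_rate)) (at_right 0)"
    by (intro tendsto_ennrealI tendsto_intros)
  ultimately have "ennreal ((1 - 0) * grad_min * volume_rate) \<le> hausdorff_measure d fibre"
    by (intro tendsto_upperbound) auto
  then show ?thesis by simp
qed

text \<open>The upper bound also shows that the Hausdorff measure is finite, so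
  \<open>enn2real\<close> does not turn an infinite area into \<open>0\<close>.\<close>

lemma level_area_bounds: "grad_min * volume_rate \<le> level_area f t" "level_area f t \<le> grad_max * volume_rate"
proof -
  let ?H = "hausdorff_measure d fibre"
  have eq: "level_area f t = enn2real ?H" by (simp add: level_area_def d_eq fibre_def)
  have fin: "?H < top" using hausdorff_measure_le by (rule order_le_less_trans) simp
  have nn: "0 \<le> grad_min * volume_rate" "0 \<le> grad_max * volume_rate"
    using grad_min_pos volume_rate_nonneg grad_max_attained grad_norm_pos by (auto intro!: mult_nonneg_nonneg) (metis less_imp_le)
  show "grad_min * volume_rate \<le> level_area f t"
    using enn2real_mono[OF hausdorff_measure_ge fin] nn by (simp add: eq)
  show "level_area f t \<le> grad_max * volume_rate"
    using enn2real_leI[OF nn(2) hausdorff_measure_le] by (simp add: eq)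
qed

lemma sublevel_volume_diff:
  assumes "a \<le> b"
  shows "sublevel_volume f b - sublevel_volume f a = measure lborel (slab a b)"
proof -
  have fm: "{x. f x \<le> s} \<in> fmeasurable lborel" for s
    using compact_sublevel by (rule fmeasurable_compact)
  have eq: "sublevel_volume f s = measure lborel {x. f x \<le> s}" for s
    unfolding sublevel_volume_def by (rule measure_completion) (use fm in auto)
  have "{x. f x \<le> b} - {x. f x \<le> a} = slab a b" by (auto simp: slab_def)
  moreover have "measure lborel ({x. f x \<le> b} - {x. f x \<le> a}) = measure lborel {x. f x \<le> b} - measure lborel {x. f x \<le> a}"
    by (rule measurable_measure_Diff[OF fm fmeasurableD[OF fm]]) (use assms in auto)
  ultimately show ?thesis by (simp add: eq)
qed

text \<open>Right and left difference quotients are the rates of the windows \<open>(t, y)\<close>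
  and \<open>(y, t)\<close>.\<close>

lemma sublevel_volume_deriv: "(sublevel_volume f has_real_derivative volume_rate) (at t)"
  unfolding has_field_derivative_iff
proof (rule tendstoI)
  fix e :: real assume "e > 0"
  then have "\<forall>\<^sub>F z in shrinking_windows t. dist (slab_rate z) volume_rate < e" by (intro tendstoD slab_rate_tendsto)
  then obtain \<kappa> where \<kappa>: "\<kappa> > 0" "\<And>a b. t - \<kappa> < a \<Longrightarrow> a < b \<Longrightarrow> b < t + \<kappa> \<Longrightarrow> dist (slab_rate (a, b)) volume_rate < e"
    unfolding eventually_shrinking_windows by blast
  have "dist ((sublevel_volume f y - sublevel_volume f t) / (y - t)) volume_rate < e" if y: "y \<noteq> t" "dist y t < \<kappa>" for y
  proof (cases "t < y")
    case True
    then have "(sublevel_volume f y - sublevel_volume f t) / (y - t) = slab_rate (t, y)"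
      by (simp add: slab_rate_def sublevel_volume_diff)
    then show ?thesis using \<kappa>(2)[of t y] \<kappa>(1) y True by (simp add: dist_real_def)
  next
    case False
    then have "y < t" using y by simp
    then have "(sublevel_volume f y - sublevel_volume f t) / (y - t) = slab_rate (y, t)"
      using sublevel_volume_diff[of y t]
      by (simp add: slab_rate_def) (metis minus_diff_eq minus_divide_divide)
    then show ?thesis using \<kappa>(2)[of y t] \<kappa>(1) y \<open>y < t\<close> by (simp add: dist_real_def)
  qed
  then show "\<forall>\<^sub>F y in at t. dist ((sublevel_volume f y - sublevel_volume f t) / (y - t)) volume_rate < e"
    unfolding eventually_at using \<kappa>(1) by blast
qed

end

subsection \<open>The global hypotheses\<close>

lemma connected_IVT:
  fixes g :: "'a::topological_space \<Rightarrow> real"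
  assumes "connected A" "continuous_on A g" "x \<in> A" "y \<in> A" "g x \<le> c" "c \<le> g y"
  shows "\<exists>z\<in>A. g z = c"
proof -
  have "connected (g ` A)" using assms(2,1) by (rule connected_continuous_image)
  then have "c \<in> g ` A" unfolding connected_iff_interval using assms(3-6) by blast
  then show ?thesis by blast
qed

text \<open>The intermediate value argument uses the product
  \<open>grad_norm p * volume_rate\<close> instead of area divided by rate, so the rate need not be
  known to be nonzero.\<close>

lemma (in regular_level) deriv_attained:
  assumes "connected fibre"
  shows "\<exists>\<xi>. f \<xi> = t \<and> volume_rate = level_area f t / norm (gradient f \<xi>)"
proof -
  let ?A = "level_area f t"
  have "\<exists>\<xi>\<in>fibre. grad_norm \<xi> * volume_rate = ?A"
  proof -
    obtain x y where "x \<in> fibre" "grad_norm x = grad_min" "y \<in> fibre" "grad_norm y = grad_max" using grad_min_attained grad_max_attained by blast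
    then show ?thesis using level_area_bounds
      by (intro connected_IVT[OF assms, of "\<lambda>p. grad_norm p * volume_rate" x y]) (auto intro!: continuous_intros continuous_grad_norm)
  qed
  then obtain \<xi> where \<xi>: "\<xi> \<in> fibre" "grad_norm \<xi> * volume_rate = ?A" by blast
  then have "volume_rate = ?A / grad_norm \<xi>" using grad_norm_pos[OF \<xi>(1)] by (simp add: nonzero_eq_divide_eq mult.commute)
  then show ?thesis using \<xi> by (auto simp: fibre_def grad_norm_def gradient_facts[OF deriv])
qed

text \<open>On the line, small fibres have points on both sides of the minimum.\<close>
lemma dimension_ge_2:
  fixes f :: "real ^ 'n \<Rightarrow> real"
  assumes f: "continuous_on UNIV f" and "f 0 = 0" and min: "\<forall>\<^sub>F x in at 0. f 0 < f x" and eps: "\<epsilon> > 0"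
    and conn: "\<And>t. t \<in> {0<..<\<epsilon>} \<Longrightarrow> connected {x. f x = t}"
  shows "2 \<le> CARD('n)"
proof (rule ccontr)
  assume "\<not> 2 \<le> CARD('n)"
  then have "CARD('n) = 1" using zero_less_card_finite[where 'a='n] by linarith
  then obtain i :: 'n where i: "UNIV = {i}" by (rule card_1_singletonE)
  obtain r where r: "r > 0" "\<And>x. x \<noteq> 0 \<Longrightarrow> norm x < r \<Longrightarrow> 0 < f x"
    using min \<open>f 0 = 0\<close> by (auto simp: eventually_at)
  define g where "g s = f (s *\<^sub>R axis i 1)" for s :: real
  have g0: "g 0 = 0" and gpos: "0 < g s" if "s \<noteq> 0" "\<bar>s\<bar> < r" for s
    using that r(2)[of "s *\<^sub>R axis i 1"] \<open>f 0 = 0\<close> by (auto simp: g_def)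
  have g: "continuous_on A g" for A unfolding g_def
    by (intro continuous_on_compose2[OF f] continuous_intros) auto
  define t where "t = min (\<epsilon> / 2) (min (g (r / 2)) (g (- r / 2)))"
  have t: "t > 0" "t < \<epsilon>" "t \<le> g (r / 2)" "t \<le> g (- r / 2)"
    using gpos[of "r / 2"] gpos[of "- r / 2"] r(1) eps by (auto simp: t_def)
  have g0: "g 0 = 0" using \<open>f 0 = 0\<close> by (simp add: g_def)
  obtain a where a: "a \<in> {0..r / 2}" "g a = t"
    using connected_IVT[of "{0..r / 2}" g 0 "r / 2" t] g g0 t r(1) by auto
  obtain b where b: "b \<in> {- r / 2..0}" "g b = t"
    using connected_IVT[of "{- r / 2..0}" g 0 "- r / 2" t] g g0 t r(1) by auto
  \<comment> \<open>The fibre has points with coordinate at least \<open>0\<close> and at most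
    \<open>0\<close>; being connected, it meets coordinate \<open>0\<close>. In dimension one that
    point is the origin, where \<open>f\<close> is \<open>0\<close> and not
    \<open>t\<close>.\<close>
  have "\<exists>z\<in>{x. f x = t}. z $ i = 0"
    using a b by (intro connected_IVT[OF conn, of t _ "b *\<^sub>R axis i 1" "a *\<^sub>R axis i 1"])
      (auto simp: g_def t intro!: continuous_intros)
  then obtain z where z: "f z = t" "z $ i = 0" by blast
  have "z $ j = 0" for j using z(2) i by (metis UNIV_I singletonD)
  then have "z = 0" by (simp add: vec_eq_iff)
  then show False using z t \<open>f 0 = 0\<close> by simp
qed

text \<open>Properness bounds the zero set and the preimage of \<open>{0..s}\<close>; the danger is
  the region where \<open>f\<close> is negative. Outside a ball containing all zeros
  \<open>f\<close> has one sign, since that complement is connected. If the sign were negative, the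
  maximum over the ball would be a global one with positive value, contradicting regularity.\<close>

lemma compact_sublevel_of_proper:
  fixes f :: "'a::euclidean_space \<Rightarrow> real"
  assumes dim: "2 \<le> DIM('a)"
    and deriv: "\<And>x. (f has_derivative f' x) (at x)" and "f 0 = 0" and min: "\<forall>\<^sub>F x in at 0. f 0 < f x"
    and proper: "\<And>K. compact K \<Longrightarrow> compact (f -` K)"
    and regular: "\<And>x. f x > 0 \<Longrightarrow> f' x \<noteq> (\<lambda>h. 0)"
  shows "compact {x. f x \<le> s}"
proof -
  have f: "continuous_on A f" for A
    using deriv by (intro continuous_at_imp_continuous_on ballI has_derivative_continuous) blast
  have "bounded (f -` {0})" by (intro compact_imp_bounded proper) simp
  then obtain R where R: "R > 0" "\<And>x. f x = 0 \<Longrightarrow> norm x \<le> R"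
    unfolding bounded_pos by auto
  have conn: "connected (- cball (0::'a) R)"
    using dim by (intro connected_complement_bounded_convex) auto
  have pos: "f x > 0" if x: "x \<in> - cball 0 R" for x
  proof (rule ccontr)
    assume nx: "\<not> f x > 0"
    have neg: "f y \<le> 0" if y: "y \<in> - cball 0 R" for y
    proof (rule ccontr)
      assume "\<not> f y \<le> 0"
      then obtain z where "z \<in> - cball 0 R" "f z = 0"
        using connected_IVT[OF conn f x y, of 0] nx by auto
      then show False using R(2)[of z] by simp
    qed
    obtain r where r: "r > 0" "\<And>x. x \<noteq> 0 \<Longrightarrow> norm x < r \<Longrightarrow> 0 < f x"
      using min \<open>f 0 = 0\<close> by (auto simp: eventually_at)
    \<comment> \<open>A nonzero point near the strict minimum, inside the ball, shows that the
      maximum over the ball is positive and so exceeds all values outside.\<close>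
    obtain u :: 'a where u: "u \<in> Basis" using nonempty_Basis by blast
    define v where "v = min (r / 2) R *\<^sub>R u"
    have nv: "norm v = min (r / 2) R" using u R(1) r(1) by (simp add: v_def min_def)
    then have v: "v \<in> cball 0 R" "0 < f v" using r R(1) by (auto intro!: r(2))
    obtain z where z: "z \<in> cball 0 R" "\<And>y. y \<in> cball 0 R \<Longrightarrow> f y \<le> f z"
      using continuous_attains_sup[of "cball 0 R" f] f R(1) by auto
    have "f z > 0" using z(2)[OF v(1)] v(2) by simp
    moreover have "f y \<le> f z" for y
      using z(2)[of y] neg[of y] \<open>f z > 0\<close> by (cases "y \<in> cball 0 R") auto
    then have "f' z = (\<lambda>h. 0)" by (intro has_derivative_local_max[OF deriv]) auto
    ultimately show False using regular by blast
  qed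
  have "{x. f x \<le> s} \<subseteq> cball 0 R \<union> f -` {0..s}"
    using pos by (fastforce simp: less_imp_le)
  moreover have "bounded (cball 0 R \<union> f -` {0..s})"
    by (auto intro!: compact_imp_bounded proper)
  ultimately have "bounded {x. f x \<le> s}" by (rule bounded_subset[rotated])
  moreover have "closed {x. f x \<le> s}" by (intro closed_Collect_le f continuous_intros)
  ultimately show ?thesis by (simp add: compact_eq_bounded_closed)
qed

theorem theorem1:
  fixes f :: "real ^ 'n \<Rightarrow> real"
    and df :: "real ^ 'n \<Rightarrow> (real ^ 'n) \<Rightarrow>\<^sub>L real"
    and \<epsilon> :: real
  assumes deriv_f: "\<And>x. (f has_derivative blinfun_apply (df x)) (at x)"
    and cont_df: "continuous_on UNIV df"
    and f_zero: "f 0 = 0"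
    and isolated_min: "\<forall>\<^sub>F x in at 0. f 0 < f x"
    and proper: "\<And>K. compact K \<Longrightarrow> compact (f -` K)"
    and regular: "\<And>t x. t > 0 \<Longrightarrow> f x = t \<Longrightarrow> df x \<noteq> 0"
    and eps_pos: "\<epsilon> > 0"
    and connected_fibre: "\<And>t. t \<in> {0<..<\<epsilon>} \<Longrightarrow> connected {x. f x = t}"
  shows "\<forall>t\<in>{0<..<\<epsilon>}.
           sublevel_volume f differentiable (at t) \<and>
           (\<exists>\<xi>. f \<xi> = t \<and> deriv (sublevel_volume f) t = level_area f t / norm (gradient f \<xi>))"
proof
  fix t assume t: "t \<in> {0<..<\<epsilon>}"
  have f: "continuous_on UNIV f"
    using deriv_f by (intro continuous_at_imp_continuous_on ballI has_derivative_continuous) blast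
  have dim: "2 \<le> CARD('n)"
    by (rule dimension_ge_2[OF f f_zero isolated_min eps_pos connected_fibre])
  have regular': "blinfun_apply (df x) \<noteq> (\<lambda>h. 0)" if "f x > 0" for x
    using regular[OF that refl] by (metis blinfun_eqI zero_blinfun.rep_eq)
  have sub: "compact {x. f x \<le> s}" for s
    by (rule compact_sublevel_of_proper[OF _ deriv_f f_zero isolated_min proper regular']) (use dim in auto)
  \<comment> \<open>If \<open>f\<close> stayed below \<open>t\<close>, the whole space would be a
    compact sublevel set. Nonemptiness of the fibre has to be proved, as the empty set is connected
    too.\<close>
  have "\<exists>y. t \<le> f y"
  proof (rule ccontr)
    assume "\<nexists>y. t \<le> f y"
    then have "{x. f x \<le> t} = UNIV" by (auto simp: not_le less_imp_le)
    then show False using sub[of t] not_compact_UNIV by metis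
  qed
  then obtain y where "t \<le> f y" by blast
  then have ne: "\<exists>x. f x = t"
    using connected_IVT[of UNIV f 0 y t] f f_zero t by (auto simp: convex_connected)
  interpret regular_level f df t "CARD('n) - 1"
    by unfold_locales (use dim deriv_f cont_df sub regular t ne in auto)
  have "connected fibre" using connected_fibre[OF t] by (simp add: fibre_def)
  from deriv_attained[OF this] show "sublevel_volume f differentiable (at t) \<and>
      (\<exists>\<xi>. f \<xi> = t \<and> deriv (sublevel_volume f) t = level_area f t / norm (gradient f \<xi>))"
    using sublevel_volume_deriv DERIV_imp_deriv[OF sublevel_volume_deriv]
    by (auto simp: real_differentiable_def)
qed

end
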